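(* Let $R$ be an associative ring with unity and let $M$ be a right $R$-module. If $M$ has finite uniform dimension ($\operatorname{u.dim}(M)<\infty$) or finite hollow dimension ($\operatorname{h.dim}(M)<\infty$), then $M=P\oplus N$ for some projective submodule $P$ of $M$ and some stable submodule $N$ of $M$.
   Context: Modules are unital right modules. A module is called stable if it has no nonzero projective direct summand (the zero module is stable). A nonzero module is uniform if each of its nonzero submodules is essential in it; a nonzero module is hollow if each of its proper submodules is superfluous in it. (A submodule $K\subseteq M$ is essential if $K\cap L=0$ implies $L=0$ for every submodule $L$ of $M$; it is superfluous if $K+L=M$ implies $L=M$ for every submodule $L$ of $M$.) The uniform dimension $\operatorname{u.dim}(M)$ is the Goldie dimension of the submodule lattice of $M$: $\operatorname{u.dim}(M)=n$ if there are uniform submodules $U_1,\dots,U_n$ of $M$ whose sum is direct and essential in $M$ (then $n$ is unique), and $\operatorname{u.dim}(M)=\infty$ if there is no such $n$; equivalently, $\operatorname{u.dim}(M)=\infty$ if and only if $M$ contains an infinite direct sum of nonzero submodules. The hollow dimension $\operatorname{h.dim}(M)$ is the Goldie dimension of the dual of the submodule lattice of $M$: $\operatorname{h.dim}(M)=n$ if there are proper submodules $K_1,\dots,K_n$ of $M$ such that each $M/K_i$ is hollow, $K_i+\bigcap_{j\neq i}K_j=M$ for every $i$, and $\bigcap_i K_i$ is superfluous in $M$ (then $n$ is unique); $\operatorname{h.dim}(M)=\infty$ if there is no such $n$. The zero module has both dimensions equal to $0$ (and an empty intersection of submodules of $M$ is $M$). *)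

theory Defs
  imports "HOL-Algebra.Module" "HOL-Algebra.AbelCoset" "HOL-Library.Extended_Nat"
begin

section \<open>Right modules over a not necessarily commutative ring\<close>

text \<open>The library locale of modules demands a commutative ring. We keep its record type (and with it
  the library predicate \<open>submodule\<close>, which needs no commutativity), but read the scalar operation as an
  action from the right: the record field, which takes the scalar first, is written with the module
  element first.\<close>

abbreviation (input) right_smult :: "'m \<Rightarrow> ('r, 'm, 'y) module_scheme \<Rightarrow> 'r \<Rightarrow> 'm"
    (\<open>(_ \<cdot>\<^bsub>_\<^esub> _)\<close> [70, 0, 71] 70)
  where "x \<cdot>\<^bsub>M\<^esub> a \<equiv> a \<odot>\<^bsub>M\<^esub> x"

locale right_module = R?: ring R + M?: abelian_group M
  for R :: "('r, 'x) ring_scheme" (structure)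
    and M :: "('r, 'm, 'y) module_scheme" (structure) +
  assumes smult_closed [simp, intro]:
      "\<lbrakk>x \<in> carrier M; a \<in> carrier R\<rbrakk> \<Longrightarrow> x \<cdot>\<^bsub>M\<^esub> a \<in> carrier M"
    and smult_add_scalar:
      "\<lbrakk>x \<in> carrier M; a \<in> carrier R; b \<in> carrier R\<rbrakk> \<Longrightarrow>
        x \<cdot>\<^bsub>M\<^esub> (a \<oplus>\<^bsub>R\<^esub> b) = x \<cdot>\<^bsub>M\<^esub> a \<oplus>\<^bsub>M\<^esub> x \<cdot>\<^bsub>M\<^esub> b"
    and smult_add_vector:
      "\<lbrakk>x \<in> carrier M; y \<in> carrier M; a \<in> carrier R\<rbrakk> \<Longrightarrow>
        (x \<oplus>\<^bsub>M\<^esub> y) \<cdot>\<^bsub>M\<^esub> a = x \<cdot>\<^bsub>M\<^esub> a \<oplus>\<^bsub>M\<^esub> y \<cdot>\<^bsub>M\<^esub> a"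
    and smult_assoc:
      "\<lbrakk>x \<in> carrier M; a \<in> carrier R; b \<in> carrier R\<rbrakk> \<Longrightarrow>
        x \<cdot>\<^bsub>M\<^esub> (a \<otimes>\<^bsub>R\<^esub> b) = (x \<cdot>\<^bsub>M\<^esub> a) \<cdot>\<^bsub>M\<^esub> b"
    and smult_one [simp]:
      "x \<in> carrier M \<Longrightarrow> x \<cdot>\<^bsub>M\<^esub> \<one>\<^bsub>R\<^esub> = x"

definition right_hom ::
    "('r, 'x) ring_scheme \<Rightarrow> ('r, 'a, 'y) module_scheme \<Rightarrow> ('r, 'b, 'z) module_scheme \<Rightarrow> ('a \<Rightarrow> 'b) set"
  where "right_hom R A B =
    {f \<in> hom (add_monoid A) (add_monoid B).
       \<forall>x\<in>carrier A. \<forall>a\<in>carrier R. f (x \<cdot>\<^bsub>A\<^esub> a) = f x \<cdot>\<^bsub>B\<^esub> a}"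

text \<open>A submodule \<open>N\<close> of \<open>M\<close> is a set; regarded as a module it is \<open>M\<lparr>carrier := N\<rparr>\<close>.\<close>

abbreviation sub_mod :: "('r, 'm, 'y) module_scheme \<Rightarrow> 'm set \<Rightarrow> ('r, 'm, 'y) module_scheme"
  where "sub_mod M N \<equiv> M\<lparr>carrier := N\<rparr>"

text \<open>The fields \<open>mult\<close> and \<open>one\<close> of a module record are irrelevant.\<close>

definition quot_mod :: "('r, 'm, 'y) module_scheme \<Rightarrow> 'm set \<Rightarrow> ('r, 'm set) module"
  where "quot_mod M K =
    \<lparr>carrier = a_rcosets\<^bsub>M\<^esub> K, mult = undefined, one = undefined,
     zero = K, add = set_add M, smult = (\<lambda>a X. \<Union>x\<in>X. K +>\<^bsub>M\<^esub> (x \<cdot>\<^bsub>M\<^esub> a))\<rparr>"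

definition is_direct_sum ::
    "('r, 'x) ring_scheme \<Rightarrow> ('r, 'm, 'y) module_scheme \<Rightarrow> 'm set \<Rightarrow> 'm set \<Rightarrow> bool"
  where "is_direct_sum R M P N \<longleftrightarrow>
    submodule P R M \<and> submodule N R M \<and> P <+>\<^bsub>M\<^esub> N = carrier M \<and> P \<inter> N = {\<zero>\<^bsub>M\<^esub>}"

section \<open>Projective and stable modules\<close>

text \<open>Projectivity is the lifting property against all surjective homomorphisms \<open>A \<rightarrow> B\<close>. A
  definition cannot quantify over types, so the test modules live on two fixed types, large enough for
  \<open>B = P\<close> and for \<open>A\<close> the free module on the set \<open>P\<close> (finitely supported functions). Lemma
  \<open>projective_lift\<close> below shows that the lifting property then holds for \<open>A\<close> and \<open>B\<close> on arbitrary
  types, so nothing is lost.\<close>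

definition projective_module :: "('r, 'x) ring_scheme \<Rightarrow> ('r, 'm, 'y) module_scheme \<Rightarrow> bool"
  where "projective_module R P \<longleftrightarrow>
    (\<forall>(A :: ('r, 'm \<Rightarrow> 'r) module) (B :: ('r, 'm) module) g f.
       right_module R A \<and> right_module R B \<and>
       g \<in> right_hom R A B \<and> g ` carrier A = carrier B \<and> f \<in> right_hom R P B \<longrightarrow>
       (\<exists>h\<in>right_hom R P A. \<forall>x\<in>carrier P. g (h x) = f x))"

definition stable_module :: "('r, 'x) ring_scheme \<Rightarrow> ('r, 'm, 'y) module_scheme \<Rightarrow> bool"
  where "stable_module R M \<longleftrightarrow>
    (\<forall>P N. is_direct_sum R M P N \<and> projective_module R (sub_mod M P) \<longrightarrow> P = {\<zero>\<^bsub>M\<^esub>})"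

section \<open>Uniform and hollow dimension\<close>

definition essential :: "('r, 'x) ring_scheme \<Rightarrow> ('r, 'm, 'y) module_scheme \<Rightarrow> 'm set \<Rightarrow> bool"
  where "essential R M K \<longleftrightarrow> submodule K R M \<and>
    (\<forall>L. submodule L R M \<longrightarrow> K \<inter> L = {\<zero>\<^bsub>M\<^esub>} \<longrightarrow> L = {\<zero>\<^bsub>M\<^esub>})"

definition superfluous :: "('r, 'x) ring_scheme \<Rightarrow> ('r, 'm, 'y) module_scheme \<Rightarrow> 'm set \<Rightarrow> bool"
  where "superfluous R M K \<longleftrightarrow> submodule K R M \<and>
    (\<forall>L. submodule L R M \<longrightarrow> K <+>\<^bsub>M\<^esub> L = carrier M \<longrightarrow> L = carrier M)"

definition uniform_module :: "('r, 'x) ring_scheme \<Rightarrow> ('r, 'm, 'y) module_scheme \<Rightarrow> bool"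
  where "uniform_module R M \<longleftrightarrow> carrier M \<noteq> {\<zero>\<^bsub>M\<^esub>} \<and>
    (\<forall>N. submodule N R M \<and> N \<noteq> {\<zero>\<^bsub>M\<^esub>} \<longrightarrow> essential R M N)"

definition hollow_module :: "('r, 'x) ring_scheme \<Rightarrow> ('r, 'm, 'y) module_scheme \<Rightarrow> bool"
  where "hollow_module R M \<longleftrightarrow> carrier M \<noteq> {\<zero>\<^bsub>M\<^esub>} \<and>
    (\<forall>N. submodule N R M \<and> N \<noteq> carrier M \<longrightarrow> superfluous R M N)"

definition submod_sum :: "('r, 'm, 'y) module_scheme \<Rightarrow> ('i \<Rightarrow> 'm set) \<Rightarrow> 'i set \<Rightarrow> 'm set"
  where "submod_sum M U I = {\<Oplus>\<^bsub>M\<^esub>i\<in>I. u i | u. u \<in> (\<Pi> i\<in>I. U i)}"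

text \<open>Intersecting with the carrier makes the intersection of the empty family the whole module.\<close>

definition submod_Int :: "('r, 'm, 'y) module_scheme \<Rightarrow> ('i \<Rightarrow> 'm set) \<Rightarrow> 'i set \<Rightarrow> 'm set"
  where "submod_Int M K I = carrier M \<inter> (\<Inter>i\<in>I. K i)"

definition has_udim :: "('r, 'x) ring_scheme \<Rightarrow> ('r, 'm, 'y) module_scheme \<Rightarrow> nat \<Rightarrow> bool"
  where "has_udim R M n \<longleftrightarrow>
    (\<exists>U. (\<forall>i\<in>{1..n}. submodule (U i) R M \<and> uniform_module R (sub_mod M (U i))) \<and>
         (\<forall>i\<in>{1..n}. U i \<inter> submod_sum M U ({1..n} - {i}) = {\<zero>\<^bsub>M\<^esub>}) \<and>
         essential R M (submod_sum M U {1..n}))"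

definition has_hdim :: "('r, 'x) ring_scheme \<Rightarrow> ('r, 'm, 'y) module_scheme \<Rightarrow> nat \<Rightarrow> bool"
  where "has_hdim R M n \<longleftrightarrow>
    (\<exists>K. (\<forall>i\<in>{1..n}. submodule (K i) R M \<and> K i \<noteq> carrier M \<and> hollow_module R (quot_mod M (K i))) \<and>
         (\<forall>i\<in>{1..n}. K i <+>\<^bsub>M\<^esub> submod_Int M K ({1..n} - {i}) = carrier M) \<and>
         superfluous R M (submod_Int M K {1..n}))"

definition udim :: "('r, 'x) ring_scheme \<Rightarrow> ('r, 'm, 'y) module_scheme \<Rightarrow> enat"
  where "udim R M = (if \<exists>n. has_udim R M n then enat (THE n. has_udim R M n) else \<infinity>)"

definition hdim :: "('r, 'x) ring_scheme \<Rightarrow> ('r, 'm, 'y) module_scheme \<Rightarrow> enat"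
  where "hdim R M = (if \<exists>n. has_hdim R M n then enat (THE n. has_hdim R M n) else \<infinity>)"

section \<open>Submodules and quotients are right modules\<close>

lemma right_moduleI:
  fixes R (structure) and M (structure)
  assumes "ring R" "abelian_group M"
    and "\<And>x a. \<lbrakk>x \<in> carrier M; a \<in> carrier R\<rbrakk> \<Longrightarrow> x \<cdot>\<^bsub>M\<^esub> a \<in> carrier M"
    and "\<And>x a b. \<lbrakk>x \<in> carrier M; a \<in> carrier R; b \<in> carrier R\<rbrakk> \<Longrightarrow>
        x \<cdot>\<^bsub>M\<^esub> (a \<oplus>\<^bsub>R\<^esub> b) = x \<cdot>\<^bsub>M\<^esub> a \<oplus>\<^bsub>M\<^esub> x \<cdot>\<^bsub>M\<^esub> b"
    and "\<And>x y a. \<lbrakk>x \<in> carrier M; y \<in> carrier M; a \<in> carrier R\<rbrakk> \<Longrightarrow>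
        (x \<oplus>\<^bsub>M\<^esub> y) \<cdot>\<^bsub>M\<^esub> a = x \<cdot>\<^bsub>M\<^esub> a \<oplus>\<^bsub>M\<^esub> y \<cdot>\<^bsub>M\<^esub> a"
    and "\<And>x a b. \<lbrakk>x \<in> carrier M; a \<in> carrier R; b \<in> carrier R\<rbrakk> \<Longrightarrow>
        x \<cdot>\<^bsub>M\<^esub> (a \<otimes>\<^bsub>R\<^esub> b) = (x \<cdot>\<^bsub>M\<^esub> a) \<cdot>\<^bsub>M\<^esub> b"
    and "\<And>x. x \<in> carrier M \<Longrightarrow> x \<cdot>\<^bsub>M\<^esub> \<one>\<^bsub>R\<^esub> = x"
  shows "right_module R M"
  by (intro right_module.intro right_module_axioms.intro assms)

lemma abelian_group_of_comm_group:
  assumes "comm_group G" "carrier H = carrier G" "add H = monoid.mult G" "zero H = monoid.one G"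
  shows "abelian_group H"
proof -
  interpret G: comm_group G by fact
  show ?thesis
    by (rule abelian_groupI) (use G.l_inv_ex in \<open>auto simp: assms(2-) G.m_ac\<close>)
qed

lemma right_module_sub_mod:
  assumes "right_module R M" "submodule N R M"
  shows "right_module R (sub_mod M N)"
proof -
  interpret right_module R M by fact
  interpret N: submodule N R M by fact
  have sub: "x \<in> carrier M" if "x \<in> N" for x
    using N.subset that by auto
  have am: "abelian_monoid (sub_mod M N)"
    using comm_monoid.submonoid_is_comm_monoid[OF M.a_comm_monoid
        N.subgroup_is_submonoid]
    by (simp add: abelian_monoid_def)
  have "group (add_monoid (sub_mod M N))"
    using N.subgroup_is_group[OF M.a_group] by simp
  with am have "abelian_group (sub_mod M N)"
    by (auto simp: abelian_group_def abelian_group_axioms_def abelian_monoid_def comm_group_def)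
  then show ?thesis
    by (intro right_moduleI R.ring_axioms)
      (use N.smult_closed in \<open>auto simp: sub smult_add_scalar smult_add_vector smult_assoc\<close>)
qed

lemma right_module_quot_mod:
  assumes "right_module R M" "submodule K R M"
  shows "right_module R (quot_mod M K)"
proof -
  interpret right_module R M by fact
  interpret K: submodule K R M by fact
  interpret K: abelian_subgroup K M
    by (intro abelian_subgroupI3 additive_subgroup.intro K.subgroup_axioms M.abelian_group_axioms)
  let ?Q = "quot_mod M K"
  have "comm_group (M A_Mod K)"
    by (rule K.a_factorgroup_is_comm_group)
  then have ag: "abelian_group ?Q"
    by (rule abelian_group_of_comm_group)
      (simp_all add: quot_mod_def A_FactGroup_def FactGroup_def A_RCOSETS_def set_add_def)
  have car: "carrier ?Q = (\<lambda>x. K +>\<^bsub>M\<^esub> x) ` carrier M"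
    by (auto simp: quot_mod_def A_RCOSETS_def')
  have add: "(K +>\<^bsub>M\<^esub> x) \<oplus>\<^bsub>?Q\<^esub> (K +>\<^bsub>M\<^esub> y) = K +>\<^bsub>M\<^esub> (x \<oplus>\<^bsub>M\<^esub> y)"
    if "x \<in> carrier M" "y \<in> carrier M" for x y
    using that by (simp add: quot_mod_def K.a_rcos_sum)
  have sm: "(K +>\<^bsub>M\<^esub> x) \<cdot>\<^bsub>?Q\<^esub> a = K +>\<^bsub>M\<^esub> (x \<cdot>\<^bsub>M\<^esub> a)"
    if x: "x \<in> carrier M" and a: "a \<in> carrier R" for x a
  proof -
    have "K +>\<^bsub>M\<^esub> (y \<cdot>\<^bsub>M\<^esub> a) = K +>\<^bsub>M\<^esub> (x \<cdot>\<^bsub>M\<^esub> a)" if y: "y \<in> K +>\<^bsub>M\<^esub> x" for y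
    proof -
      obtain k where k: "k \<in> K" "y = k \<oplus>\<^bsub>M\<^esub> x"
        using y by (auto simp: a_r_coset_def')
      have kM: "k \<in> carrier M" using k(1) by (rule K.a_Hcarr)
      have "K +>\<^bsub>M\<^esub> (y \<cdot>\<^bsub>M\<^esub> a) = K +>\<^bsub>M\<^esub> (k \<cdot>\<^bsub>M\<^esub> a \<oplus>\<^bsub>M\<^esub> x \<cdot>\<^bsub>M\<^esub> a)"
        using k(2) kM x a by (simp add: smult_add_vector)
      also have "\<dots> = K +>\<^bsub>M\<^esub> (x \<cdot>\<^bsub>M\<^esub> a)"
        using M.a_coset_add_assoc[OF K.a_subset, of "k \<cdot>\<^bsub>M\<^esub> a" "x \<cdot>\<^bsub>M\<^esub> a"]
          K.a_rcos_const[OF K.smult_closed[OF a k(1)]] kM x a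
        by simp
      finally show ?thesis .
    qed
    moreover have "x \<in> K +>\<^bsub>M\<^esub> x" using x by (rule K.a_rcos_self)
    ultimately have "(\<Union>y\<in>K +>\<^bsub>M\<^esub> x. K +>\<^bsub>M\<^esub> (y \<cdot>\<^bsub>M\<^esub> a)) = K +>\<^bsub>M\<^esub> (x \<cdot>\<^bsub>M\<^esub> a)"
      by (intro UN_constant_eq ballI)
    then show ?thesis by (simp only: quot_mod_def module.simps)
  qed
  show ?thesis
  proof (rule right_moduleI[OF R.ring_axioms ag], goal_cases)
    case (1 X a)
    then show ?case using sm unfolding car by force
  next
    case (2 X a b)
    then obtain x where "x \<in> carrier M" "X = K +>\<^bsub>M\<^esub> x" unfolding car by blast
    with 2 show ?case by (simp only: sm add smult_add_scalar smult_closed R.a_closed)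
  next
    case (3 X Y a)
    then obtain x y where "x \<in> carrier M" "X = K +>\<^bsub>M\<^esub> x" "y \<in> carrier M" "Y = K +>\<^bsub>M\<^esub> y"
      unfolding car by blast
    with 3 show ?case by (simp only: sm add smult_add_vector smult_closed M.a_closed)
  next
    case (4 X a b)
    then obtain x where "x \<in> carrier M" "X = K +>\<^bsub>M\<^esub> x" unfolding car by blast
    with 4 show ?case by (simp only: sm smult_assoc smult_closed R.m_closed)
  next
    case (5 X)
    then obtain x where "x \<in> carrier M" "X = K +>\<^bsub>M\<^esub> x" unfolding car by blast
    then show ?case by (simp only: sm smult_one R.one_closed)
  qed
qed

section \<open>The lifting property does not depend on the types of the test modules\<close>

definition free_mod :: "('r, 'x) ring_scheme \<Rightarrow> 'm set \<Rightarrow> ('r, 'm \<Rightarrow> 'r) module"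
  where "free_mod R X =
    \<lparr>carrier = {v. (\<forall>x. v x \<in> carrier R) \<and> finite {x. v x \<noteq> \<zero>\<^bsub>R\<^esub>} \<and> {x. v x \<noteq> \<zero>\<^bsub>R\<^esub>} \<subseteq> X},
     mult = undefined, one = undefined,
     zero = (\<lambda>_. \<zero>\<^bsub>R\<^esub>), add = (\<lambda>v w x. v x \<oplus>\<^bsub>R\<^esub> w x), smult = (\<lambda>a v x. v x \<otimes>\<^bsub>R\<^esub> a)\<rparr>"

lemma right_module_free_mod:
  assumes "ring R"
  shows "right_module R (free_mod R X)"
proof -
  interpret ring R by fact
  let ?F = "free_mod R X"
  have addc: "v \<oplus>\<^bsub>?F\<^esub> w \<in> carrier ?F" if "v \<in> carrier ?F" "w \<in> carrier ?F" for v w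
  proof -
    have "{x. v x \<oplus>\<^bsub>R\<^esub> w x \<noteq> \<zero>\<^bsub>R\<^esub>} \<subseteq> {x. v x \<noteq> \<zero>\<^bsub>R\<^esub>} \<union> {x. w x \<noteq> \<zero>\<^bsub>R\<^esub>}" by auto
    with that show ?thesis
      by (auto simp: free_mod_def intro: finite_subset)
  qed
  have smc: "v \<cdot>\<^bsub>?F\<^esub> a \<in> carrier ?F" if "v \<in> carrier ?F" "a \<in> carrier R" for v a
  proof -
    have "{x. v x \<otimes>\<^bsub>R\<^esub> a \<noteq> \<zero>\<^bsub>R\<^esub>} \<subseteq> {x. v x \<noteq> \<zero>\<^bsub>R\<^esub>}" using that by auto
    with that show ?thesis
      by (auto simp: free_mod_def intro: finite_subset)
  qed
  have neg: "\<exists>w\<in>carrier ?F. w \<oplus>\<^bsub>?F\<^esub> v = \<zero>\<^bsub>?F\<^esub>" if v: "v \<in> carrier ?F" for v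
  proof
    have "{x. \<ominus>\<^bsub>R\<^esub> v x \<noteq> \<zero>\<^bsub>R\<^esub>} \<subseteq> {x. v x \<noteq> \<zero>\<^bsub>R\<^esub>}" by auto
    with v show "(\<lambda>x. \<ominus>\<^bsub>R\<^esub> v x) \<in> carrier ?F"
      by (auto simp: free_mod_def intro: finite_subset)
    show "(\<lambda>x. \<ominus>\<^bsub>R\<^esub> v x) \<oplus>\<^bsub>?F\<^esub> v = \<zero>\<^bsub>?F\<^esub>"
      using v by (auto simp: free_mod_def l_neg)
  qed
  have ag: "abelian_group ?F"
    by (rule abelian_groupI[OF addc _ _ _ _ neg]) (auto simp: free_mod_def fun_eq_iff a_ac)
  show ?thesis
    by (rule right_moduleI[OF \<open>ring R\<close> ag smc])
      (auto simp: free_mod_def fun_eq_iff r_distr l_distr m_assoc)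
qed

text \<open>The linear extension of \<open>c\<close> to the free module.\<close>

definition lin_ext :: "('r, 'x) ring_scheme \<Rightarrow> ('r, 'a, 'y) module_scheme \<Rightarrow> ('m \<Rightarrow> 'a) \<Rightarrow> ('m \<Rightarrow> 'r) \<Rightarrow> 'a"
  where "lin_ext R A c v = (\<Oplus>\<^bsub>A\<^esub>x\<in>{x. v x \<noteq> \<zero>\<^bsub>R\<^esub>}. c x \<cdot>\<^bsub>A\<^esub> v x)"

lemma (in right_module) smult_zero_scalar [simp]:
  assumes "x \<in> carrier M" shows "x \<cdot>\<^bsub>M\<^esub> \<zero>\<^bsub>R\<^esub> = \<zero>\<^bsub>M\<^esub>"
proof -
  have "x \<cdot>\<^bsub>M\<^esub> \<zero>\<^bsub>R\<^esub> \<oplus>\<^bsub>M\<^esub> x \<cdot>\<^bsub>M\<^esub> \<zero>\<^bsub>R\<^esub> = x \<cdot>\<^bsub>M\<^esub> \<zero>\<^bsub>R\<^esub>"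
    using smult_add_scalar[of x "\<zero>\<^bsub>R\<^esub>" "\<zero>\<^bsub>R\<^esub>"] assms by simp
  then show ?thesis using assms by (simp add: M.add.l_cancel_one')
qed

lemma (in right_module) smult_zero_vector [simp]:
  assumes "a \<in> carrier R" shows "\<zero>\<^bsub>M\<^esub> \<cdot>\<^bsub>M\<^esub> a = \<zero>\<^bsub>M\<^esub>"
proof -
  have "\<zero>\<^bsub>M\<^esub> \<cdot>\<^bsub>M\<^esub> a \<oplus>\<^bsub>M\<^esub> \<zero>\<^bsub>M\<^esub> \<cdot>\<^bsub>M\<^esub> a = \<zero>\<^bsub>M\<^esub> \<cdot>\<^bsub>M\<^esub> a"
    using smult_add_vector[of "\<zero>\<^bsub>M\<^esub>" "\<zero>\<^bsub>M\<^esub>" a] assms by simp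
  then show ?thesis using assms by (simp add: M.add.l_cancel_one')
qed

lemma (in right_module) finsum_smult:
  assumes "finite S" "a \<in> carrier R" "f \<in> S \<rightarrow> carrier M"
  shows "(\<Oplus>\<^bsub>M\<^esub>i\<in>S. f i) \<cdot>\<^bsub>M\<^esub> a = (\<Oplus>\<^bsub>M\<^esub>i\<in>S. f i \<cdot>\<^bsub>M\<^esub> a)"
  using assms by (induction S) (auto simp: smult_add_vector Pi_def)

lemma (in right_module) lin_ext_eq:
  assumes "finite S" "S \<subseteq> X" "{x. v x \<noteq> \<zero>\<^bsub>R\<^esub>} \<subseteq> S" "\<And>x. x \<in> X \<Longrightarrow> c x \<in> carrier M"
    "\<And>x. v x \<in> carrier R"
  shows "lin_ext R M c v = (\<Oplus>\<^bsub>M\<^esub>x\<in>S. c x \<cdot>\<^bsub>M\<^esub> v x)"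
  unfolding lin_ext_def
  by (rule M.add.finprod_mono_neutral_cong_left) (use assms in auto)

lemma (in right_module) lin_ext_hom:
  assumes c: "\<And>x. x \<in> X \<Longrightarrow> c x \<in> carrier M"
  shows "lin_ext R M c \<in> right_hom R (free_mod R X) M"
proof -
  let ?F = "free_mod R X"
  interpret F: right_module R ?F by (rule right_module_free_mod[OF R.ring_axioms])
  have F: "\<And>x. v x \<in> carrier R" "finite {x. v x \<noteq> \<zero>\<^bsub>R\<^esub>}" "{x. v x \<noteq> \<zero>\<^bsub>R\<^esub>} \<subseteq> X"
    if "v \<in> carrier ?F" for v
    using that by (auto simp: free_mod_def)
  show ?thesis unfolding right_hom_def
  proof (intro CollectI conjI homI ballI)
    fix v assume "v \<in> carrier (add_monoid ?F)"
    then have v: "v \<in> carrier ?F" by simp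
    have "c x \<cdot>\<^bsub>M\<^esub> v x \<in> carrier M" if "v x \<noteq> \<zero>\<^bsub>R\<^esub>" for x
      using F[OF v] c that by blast
    then show "lin_ext R M c v \<in> carrier (add_monoid M)"
      unfolding lin_ext_def by (auto intro!: M.finsum_closed)
  next
    fix v w assume "v \<in> carrier (add_monoid ?F)" "w \<in> carrier (add_monoid ?F)"
    then have v: "v \<in> carrier ?F" and w: "w \<in> carrier ?F" by simp_all
    define S where "S = {x. v x \<noteq> \<zero>\<^bsub>R\<^esub>} \<union> {x. w x \<noteq> \<zero>\<^bsub>R\<^esub>}"
    have vw: "(v \<oplus>\<^bsub>?F\<^esub> w) = (\<lambda>x. v x \<oplus>\<^bsub>R\<^esub> w x)" by (simp add: free_mod_def)
    have S: "finite S" "S \<subseteq> X" using F[OF v] F[OF w] by (auto simp: S_def)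
    have cS: "\<And>x. x \<in> S \<Longrightarrow> c x \<in> carrier M" using S c by auto
    have "lin_ext R M c (v \<oplus>\<^bsub>?F\<^esub> w) = (\<Oplus>\<^bsub>M\<^esub>x\<in>S. c x \<cdot>\<^bsub>M\<^esub> (v x \<oplus>\<^bsub>R\<^esub> w x))"
      unfolding vw by (rule lin_ext_eq[OF S _ c]) (use F[OF v] F[OF w] in \<open>auto simp: S_def\<close>)
    also have "\<dots> = (\<Oplus>\<^bsub>M\<^esub>x\<in>S. c x \<cdot>\<^bsub>M\<^esub> v x \<oplus>\<^bsub>M\<^esub> c x \<cdot>\<^bsub>M\<^esub> w x)"
      by (rule M.finsum_cong') (use F(1)[OF v] F(1)[OF w] cS in \<open>auto simp: smult_add_scalar\<close>)
    also have "\<dots> = (\<Oplus>\<^bsub>M\<^esub>x\<in>S. c x \<cdot>\<^bsub>M\<^esub> v x) \<oplus>\<^bsub>M\<^esub> (\<Oplus>\<^bsub>M\<^esub>x\<in>S. c x \<cdot>\<^bsub>M\<^esub> w x)"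
      by (rule M.finsum_addf) (use F(1)[OF v] F(1)[OF w] cS in auto)
    also have "(\<Oplus>\<^bsub>M\<^esub>x\<in>S. c x \<cdot>\<^bsub>M\<^esub> v x) = lin_ext R M c v"
      by (rule lin_ext_eq[OF S _ c, symmetric]) (use F[OF v] in \<open>auto simp: S_def\<close>)
    also have "(\<Oplus>\<^bsub>M\<^esub>x\<in>S. c x \<cdot>\<^bsub>M\<^esub> w x) = lin_ext R M c w"
      by (rule lin_ext_eq[OF S _ c, symmetric]) (use F[OF w] in \<open>auto simp: S_def\<close>)
    finally show "lin_ext R M c (v \<otimes>\<^bsub>add_monoid ?F\<^esub> w) =
        lin_ext R M c v \<otimes>\<^bsub>add_monoid M\<^esub> lin_ext R M c w"
      by simp
  next
    fix v a assume v: "v \<in> carrier ?F" and a: "a \<in> carrier R"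
    define S where "S = {x. v x \<noteq> \<zero>\<^bsub>R\<^esub>}"
    have va: "(v \<cdot>\<^bsub>?F\<^esub> a) = (\<lambda>x. v x \<otimes>\<^bsub>R\<^esub> a)" by (simp add: free_mod_def)
    have S: "finite S" "S \<subseteq> X" using F[OF v] by (auto simp: S_def)
    have cS: "\<And>x. x \<in> S \<Longrightarrow> c x \<in> carrier M" using S c by auto
    have "lin_ext R M c (v \<cdot>\<^bsub>?F\<^esub> a) = (\<Oplus>\<^bsub>M\<^esub>x\<in>S. c x \<cdot>\<^bsub>M\<^esub> (v x \<otimes>\<^bsub>R\<^esub> a))"
      unfolding va by (rule lin_ext_eq[OF S _ c]) (use F[OF v] a in \<open>auto simp: S_def\<close>)
    also have "\<dots> = (\<Oplus>\<^bsub>M\<^esub>x\<in>S. (c x \<cdot>\<^bsub>M\<^esub> v x) \<cdot>\<^bsub>M\<^esub> a)"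
      by (rule M.finsum_cong') (use F(1)[OF v] a cS in \<open>auto simp: smult_assoc\<close>)
    also have "\<dots> = (\<Oplus>\<^bsub>M\<^esub>x\<in>S. c x \<cdot>\<^bsub>M\<^esub> v x) \<cdot>\<^bsub>M\<^esub> a"
      by (rule finsum_smult[symmetric]) (use S F(1)[OF v] a cS in auto)
    finally show "lin_ext R M c (v \<cdot>\<^bsub>?F\<^esub> a) = lin_ext R M c v \<cdot>\<^bsub>M\<^esub> a"
      by (simp add: lin_ext_def S_def)
  qed
qed

lemma right_homD:
  assumes "f \<in> right_hom R A B"
  shows "x \<in> carrier A \<Longrightarrow> f x \<in> carrier B"
    and "x \<in> carrier A \<Longrightarrow> y \<in> carrier A \<Longrightarrow> f (x \<oplus>\<^bsub>A\<^esub> y) = f x \<oplus>\<^bsub>B\<^esub> f y"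
    and "x \<in> carrier A \<Longrightarrow> a \<in> carrier R \<Longrightarrow> f (x \<cdot>\<^bsub>A\<^esub> a) = f x \<cdot>\<^bsub>B\<^esub> a"
  using assms by (auto simp: right_hom_def hom_def)

lemma right_hom_comp:
  assumes "f \<in> right_hom R A B" "g \<in> right_hom R B C"
  shows "(\<lambda>x. g (f x)) \<in> right_hom R A C"
  using right_homD[OF assms(1)] right_homD[OF assms(2)]
  by (auto simp: right_hom_def hom_def)

lemma right_hom_finsum:
  assumes "right_module R A" "right_module R B" "f \<in> right_hom R A B"
    and "finite S" "u \<in> S \<rightarrow> carrier A"
  shows "f (\<Oplus>\<^bsub>A\<^esub>i\<in>S. u i) = (\<Oplus>\<^bsub>B\<^esub>i\<in>S. f (u i))"
proof -
  interpret A: right_module R A by fact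
  interpret B: right_module R B by fact
  note f = right_homD[OF assms(3)]
  have z: "f \<zero>\<^bsub>A\<^esub> = \<zero>\<^bsub>B\<^esub>"
  proof -
    have "f \<zero>\<^bsub>A\<^esub> = f (\<zero>\<^bsub>A\<^esub> \<cdot>\<^bsub>A\<^esub> \<zero>\<^bsub>R\<^esub>)" by simp
    also have "\<dots> = f \<zero>\<^bsub>A\<^esub> \<cdot>\<^bsub>B\<^esub> \<zero>\<^bsub>R\<^esub>" by (rule f) simp_all
    also have "\<dots> = \<zero>\<^bsub>B\<^esub>" using f(1) by simp
    finally show ?thesis .
  qed
  show ?thesis
    using assms(4,5)
  proof (induction S)
    case empty
    then show ?case by (simp add: z)
  next
    case (insert i S)
    then show ?case
      by (subst A.finsum_insert, simp_all, subst B.finsum_insert)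
        (auto simp: f Pi_def)
  qed
qed

theorem projective_lift:
  fixes P :: "('r, 'm, 'y) module_scheme"
    and A :: "('r, 'a, 'u) module_scheme" and B :: "('r, 'b, 'v) module_scheme"
  assumes P: "right_module R P" "projective_module R P"
    and A: "right_module R A" and B: "right_module R B"
    and g: "g \<in> right_hom R A B" "g ` carrier A = carrier B"
    and f: "f \<in> right_hom R P B"
  shows "\<exists>h\<in>right_hom R P A. \<forall>x\<in>carrier P. g (h x) = f x"
proof -
  interpret A: right_module R A by fact
  interpret B: right_module R B by fact
  interpret P: right_module R P by fact
  let ?X = "carrier P"
  let ?F = "free_mod R ?X"
  define P' :: "('r, 'm) module" where "P' =
    \<lparr>carrier = carrier P, mult = mult P, one = one P, zero = zero P, add = add P, smult = smult P\<rparr>"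
  have "abelian_group P'"
    by (rule abelian_group_of_comm_group[OF P.a_comm_group]) (simp_all add: P'_def)
  then have P': "right_module R P'"
    by (intro right_moduleI right_module.axioms(1)[OF A])
      (auto simp: P'_def P.smult_add_scalar P.smult_add_vector P.smult_assoc)
  interpret P': right_module R P' by fact
  have F: "right_module R ?F" by (rule right_module_free_mod[OF right_module.axioms(1)[OF A]])
  define e where "e = lin_ext R P' (\<lambda>x. x)"
  have e: "e \<in> right_hom R ?F P'"
    unfolding e_def by (rule P'.lin_ext_hom) (simp add: P'_def)
  have "x \<in> e ` carrier ?F" if x: "x \<in> carrier P'" for x
  proof (cases "\<one>\<^bsub>R\<^esub> = \<zero>\<^bsub>R\<^esub>")
    case True
    then have "x = \<zero>\<^bsub>P'\<^esub>" using x P'.smult_one P'.smult_zero_scalar by metis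
    moreover have "e (\<lambda>_. \<zero>\<^bsub>R\<^esub>) = \<zero>\<^bsub>P'\<^esub>" by (simp add: e_def lin_ext_def)
    moreover have "(\<lambda>_. \<zero>\<^bsub>R\<^esub>) \<in> carrier ?F" by (simp add: free_mod_def)
    ultimately show ?thesis by force
  next
    case False
    let ?d = "(\<lambda>y. if y = x then \<one>\<^bsub>R\<^esub> else \<zero>\<^bsub>R\<^esub>)"
    have s: "{y. ?d y \<noteq> \<zero>\<^bsub>R\<^esub>} = {x}" using False by auto
    have "e ?d = (\<Oplus>\<^bsub>P'\<^esub>y\<in>{x}. y \<cdot>\<^bsub>P'\<^esub> ?d y)" unfolding e_def lin_ext_def s ..
    also have "\<dots> = x" using x by (subst P'.finsum_insert) auto
    finally have "e ?d = x" .
    moreover have "?d \<in> carrier ?F"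
      using x s by (auto simp: free_mod_def P'_def)
    ultimately show ?thesis by force
  qed
  then have surj: "e ` carrier ?F = carrier P'"
    using right_homD(1)[OF e] by blast
  have "(\<lambda>x. x) \<in> right_hom R P P'"
    by (auto simp: right_hom_def hom_def P'_def)
  then obtain s where s: "s \<in> right_hom R P ?F" "\<forall>x\<in>carrier P. e (s x) = x"
    using P(2)[unfolded projective_module_def] F P' e surj by blast
  have "\<exists>c. \<forall>x\<in>carrier P. c x \<in> carrier A \<and> g (c x) = f x"
  proof (rule bchoice, intro ballI)
    fix x assume "x \<in> carrier P"
    then have "f x \<in> g ` carrier A" using right_homD(1)[OF f] g(2) by simp
    then show "\<exists>y. y \<in> carrier A \<and> g y = f x" by auto
  qed
  then obtain c where c: "\<And>x. x \<in> carrier P \<Longrightarrow> c x \<in> carrier A"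
      "\<And>x. x \<in> carrier P \<Longrightarrow> g (c x) = f x"
    by auto
  define h where "h = (\<lambda>x. lin_ext R A c (s x))"
  have "h \<in> right_hom R P A"
    unfolding h_def by (rule right_hom_comp[OF s(1)]) (rule A.lin_ext_hom[OF c(1)])
  moreover have "g (h x) = f x" if x: "x \<in> carrier P" for x
  proof -
    define S where "S = {y. s x y \<noteq> \<zero>\<^bsub>R\<^esub>}"
    have "s x \<in> carrier ?F" using right_homD(1)[OF s(1)] x by simp
    then have S: "finite S" "S \<subseteq> carrier P" "\<And>y. s x y \<in> carrier R"
      by (auto simp: free_mod_def S_def)
    have fP': "f \<in> right_hom R P' B"
      using f by (simp add: right_hom_def hom_def P'_def)
    have "g (h x) = (\<Oplus>\<^bsub>B\<^esub>y\<in>S. g (c y \<cdot>\<^bsub>A\<^esub> s x y))"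
      unfolding h_def lin_ext_def S_def[symmetric]
      by (rule right_hom_finsum[OF A B g(1) S(1)]) (use S c(1) in auto)
    also have "\<dots> = (\<Oplus>\<^bsub>B\<^esub>y\<in>S. f (y \<cdot>\<^bsub>P'\<^esub> s x y))"
    proof (rule B.finsum_cong')
      show "(\<lambda>y. f (y \<cdot>\<^bsub>P'\<^esub> s x y)) \<in> S \<rightarrow> carrier B"
        using S right_homD(1)[OF fP'] P'.smult_closed by (auto simp: P'_def)
      fix y assume y: "y \<in> S"
      then have "y \<in> carrier P" using S by auto
      then show "g (c y \<cdot>\<^bsub>A\<^esub> s x y) = f (y \<cdot>\<^bsub>P'\<^esub> s x y)"
        using right_homD(3)[OF g(1)] right_homD(3)[OF f] c S(3) by (simp add: P'_def)
    qed simp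
    also have "\<dots> = f (e (s x))"
      unfolding e_def lin_ext_def S_def[symmetric]
      by (rule right_hom_finsum[OF P' B fP' S(1), symmetric])
        (use S P'.smult_closed in \<open>auto simp: P'_def\<close>)
    finally show ?thesis using s(2) x by simp
  qed
  ultimately show ?thesis by blast
qed

end

theory Submission
  imports Defs
begin

text \<open>
  Start from \<open>M = 0 \<oplus> M\<close> and keep splitting projective summands off the second summand: if
  \<open>M = P \<oplus> N\<close> with \<open>P\<close> projective and \<open>N\<close> is not stable, then \<open>N = p \<oplus> N'\<close> with a nonzero projective
  \<open>p\<close>, and \<open>M = (P \<oplus> p) \<oplus> N'\<close> with \<open>P \<oplus> p\<close> projective (\<open>projective_direct_sum\<close>,
  \<open>split_projective_summand\<close>). If no stable complement is ever reached, this gives infinitely many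
  decompositions \<open>M = P\<^sub>j \<oplus> N\<^sub>j\<close> in which the \<open>P\<^sub>j\<close> strictly increase and the \<open>N\<^sub>j\<close> strictly decrease.
  Finite uniform dimension and finite hollow dimension both forbid that.

  The two dimensions are one notion, read in the modular lattice of submodules and in its dual, so
  the bound is proved once, in an abstract bounded modular lattice (\<open>no_infinite_splitting\<close>). Suppose
  that the independent uniform elements \<open>u\<^sub>1, \<dots>, u\<^sub>n\<close> have essential join, and that every \<open>s\<^sub>j\<close>
  contains a nonzero \<open>p\<close> disjoint from \<open>s\<^bsub>j+1\<^esub> \<le> s\<^sub>j\<close>. The exchange argument of linear algebra yields
  \<open>j\<close> distinct elements among the \<open>u\<^sub>i\<close> whose join \<open>q\<close> is disjoint from \<open>s\<^sub>j\<close>: passing to \<open>j + 1\<close>, the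
  element \<open>q \<squnion> s\<^bsub>j+1\<^esub>\<close> is disjoint from \<open>p\<close>, hence not essential, hence misses some \<open>u\<^sub>i\<close>
  (\<open>ess_of_meets_uniforms\<close>), and this \<open>u\<^sub>i\<close> can be added. For \<open>j = n + 1\<close> this is absurd. In the
  lattice of submodules this is applied to the \<open>N\<^sub>j\<close>, in the dual lattice to the \<open>P\<^sub>j\<close>.
\<close>

section \<open>Goldie dimension in modular lattices\<close>

text \<open>The lattice lives on a carrier set and its order is a parameter, so that it can be
  instantiated both with a set of submodules and with the reversed order.\<close>

locale bounded_modular_lattice =
  fixes L :: "'a set"
    and le :: "'a \<Rightarrow> 'a \<Rightarrow> bool" (infix \<open>\<^bold>\<le>\<close> 50)
    and join :: "'a \<Rightarrow> 'a \<Rightarrow> 'a" (infixl \<open>\<^bold>\<squnion>\<close> 65)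
    and meet :: "'a \<Rightarrow> 'a \<Rightarrow> 'a" (infixl \<open>\<^bold>\<sqinter>\<close> 70)
    and bot :: 'a (\<open>\<^bold>0\<close>)
    and top :: 'a (\<open>\<^bold>1\<close>)
  assumes join_closed [simp, intro]: "\<lbrakk>x \<in> L; y \<in> L\<rbrakk> \<Longrightarrow> x \<^bold>\<squnion> y \<in> L"
    and meet_closed [simp, intro]: "\<lbrakk>x \<in> L; y \<in> L\<rbrakk> \<Longrightarrow> x \<^bold>\<sqinter> y \<in> L"
    and bot_closed [simp, intro]: "\<^bold>0 \<in> L"
    and top_closed [simp, intro]: "\<^bold>1 \<in> L"
    and le_refl: "x \<in> L \<Longrightarrow> x \<^bold>\<le> x"
    and le_trans: "\<lbrakk>x \<in> L; y \<in> L; z \<in> L; x \<^bold>\<le> y; y \<^bold>\<le> z\<rbrakk> \<Longrightarrow> x \<^bold>\<le> z"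
    and le_antisym: "\<lbrakk>x \<in> L; y \<in> L; x \<^bold>\<le> y; y \<^bold>\<le> x\<rbrakk> \<Longrightarrow> x = y"
    and join_upper1: "\<lbrakk>x \<in> L; y \<in> L\<rbrakk> \<Longrightarrow> x \<^bold>\<le> x \<^bold>\<squnion> y"
    and join_upper2: "\<lbrakk>x \<in> L; y \<in> L\<rbrakk> \<Longrightarrow> y \<^bold>\<le> x \<^bold>\<squnion> y"
    and join_least: "\<lbrakk>x \<in> L; y \<in> L; z \<in> L; x \<^bold>\<le> z; y \<^bold>\<le> z\<rbrakk> \<Longrightarrow> x \<^bold>\<squnion> y \<^bold>\<le> z"
    and meet_lower1: "\<lbrakk>x \<in> L; y \<in> L\<rbrakk> \<Longrightarrow> x \<^bold>\<sqinter> y \<^bold>\<le> x"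
    and meet_lower2: "\<lbrakk>x \<in> L; y \<in> L\<rbrakk> \<Longrightarrow> x \<^bold>\<sqinter> y \<^bold>\<le> y"
    and meet_greatest: "\<lbrakk>x \<in> L; y \<in> L; z \<in> L; z \<^bold>\<le> x; z \<^bold>\<le> y\<rbrakk> \<Longrightarrow> z \<^bold>\<le> x \<^bold>\<sqinter> y"
    and bot_least: "x \<in> L \<Longrightarrow> \<^bold>0 \<^bold>\<le> x"
    and top_greatest: "x \<in> L \<Longrightarrow> x \<^bold>\<le> \<^bold>1"
    and modular: "\<lbrakk>x \<in> L; y \<in> L; z \<in> L; x \<^bold>\<le> z\<rbrakk> \<Longrightarrow> (x \<^bold>\<squnion> y) \<^bold>\<sqinter> z \<^bold>\<le> x \<^bold>\<squnion> y \<^bold>\<sqinter> z"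
begin

lemma join_commute: "\<lbrakk>x \<in> L; y \<in> L\<rbrakk> \<Longrightarrow> x \<^bold>\<squnion> y = y \<^bold>\<squnion> x"
  by (intro le_antisym join_least join_upper1 join_upper2 join_closed)

lemma meet_commute: "\<lbrakk>x \<in> L; y \<in> L\<rbrakk> \<Longrightarrow> x \<^bold>\<sqinter> y = y \<^bold>\<sqinter> x"
  by (intro le_antisym meet_greatest meet_lower1 meet_lower2 meet_closed)

lemma le_bot: "\<lbrakk>x \<in> L; x \<^bold>\<le> \<^bold>0\<rbrakk> \<Longrightarrow> x = \<^bold>0"
  by (intro le_antisym bot_least bot_closed)

lemma join_bot: "x \<in> L \<Longrightarrow> x \<^bold>\<squnion> \<^bold>0 = x"
  by (intro le_antisym join_least join_upper1 le_refl bot_least join_closed bot_closed)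

lemma meet_mono:
  "\<lbrakk>x \<in> L; x' \<in> L; y \<in> L; y' \<in> L; x \<^bold>\<le> x'; y \<^bold>\<le> y'\<rbrakk> \<Longrightarrow> x \<^bold>\<sqinter> y \<^bold>\<le> x' \<^bold>\<sqinter> y'"
  using le_trans[of "x \<^bold>\<sqinter> y" x x'] le_trans[of "x \<^bold>\<sqinter> y" y y']
  by (simp add: meet_greatest meet_lower1 meet_lower2)

lemma join_mono:
  "\<lbrakk>x \<in> L; x' \<in> L; y \<in> L; y' \<in> L; x \<^bold>\<le> x'; y \<^bold>\<le> y'\<rbrakk> \<Longrightarrow> x \<^bold>\<squnion> y \<^bold>\<le> x' \<^bold>\<squnion> y'"
  using le_trans[of x x' "x' \<^bold>\<squnion> y'"] le_trans[of y y' "x' \<^bold>\<squnion> y'"]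
  by (simp add: join_least join_upper1 join_upper2)

lemma disjoint_mono:
  "\<lbrakk>x \<in> L; x' \<in> L; y \<in> L; y' \<in> L; x \<^bold>\<le> x'; y \<^bold>\<le> y'; x' \<^bold>\<sqinter> y' = \<^bold>0\<rbrakk> \<Longrightarrow> x \<^bold>\<sqinter> y = \<^bold>0"
  using meet_mono[of x x' y y'] le_bot[of "x \<^bold>\<sqinter> y"] by simp

lemma meet_absorb: "\<lbrakk>x \<in> L; y \<in> L; x \<^bold>\<le> y\<rbrakk> \<Longrightarrow> x \<^bold>\<sqinter> y = x"
  by (intro le_antisym meet_greatest meet_lower1 le_refl meet_closed)

lemma dual: "bounded_modular_lattice L (\<lambda>x y. y \<^bold>\<le> x) (\<^bold>\<sqinter>) (\<^bold>\<squnion>) \<^bold>1 \<^bold>0"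
proof (unfold_locales, goal_cases)
  case (16 x y z)
  then show ?case using modular[of z y x] by (simp add: join_commute meet_commute)
next
  case (6 x y z)
  then show ?case using le_trans[of z y x] by simp
next
  case (7 x y)
  then show ?case using le_antisym[of x y] by simp
qed (simp_all add: le_refl join_upper1 join_upper2 join_least meet_lower1 meet_lower2
      meet_greatest bot_least top_greatest)

lemma join_assoc:
  assumes L: "x \<in> L" "y \<in> L" "z \<in> L"
  shows "(x \<^bold>\<squnion> y) \<^bold>\<squnion> z = x \<^bold>\<squnion> (y \<^bold>\<squnion> z)"
proof (rule le_antisym)
  have "x \<^bold>\<squnion> y \<^bold>\<le> x \<^bold>\<squnion> (y \<^bold>\<squnion> z)" using L by (intro join_mono le_refl join_upper1) auto
  moreover have "z \<^bold>\<le> x \<^bold>\<squnion> (y \<^bold>\<squnion> z)"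
    using L le_trans[of z "y \<^bold>\<squnion> z" "x \<^bold>\<squnion> (y \<^bold>\<squnion> z)"] by (simp add: join_upper2)
  ultimately show "(x \<^bold>\<squnion> y) \<^bold>\<squnion> z \<^bold>\<le> x \<^bold>\<squnion> (y \<^bold>\<squnion> z)" using L by (simp add: join_least)
  have "y \<^bold>\<squnion> z \<^bold>\<le> (x \<^bold>\<squnion> y) \<^bold>\<squnion> z" using L by (intro join_mono le_refl join_upper2) auto
  moreover have "x \<^bold>\<le> (x \<^bold>\<squnion> y) \<^bold>\<squnion> z"
    using L le_trans[of x "x \<^bold>\<squnion> y" "(x \<^bold>\<squnion> y) \<^bold>\<squnion> z"] by (simp add: join_upper1)
  ultimately show "x \<^bold>\<squnion> (y \<^bold>\<squnion> z) \<^bold>\<le> (x \<^bold>\<squnion> y) \<^bold>\<squnion> z" using L by (simp add: join_least)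
qed (use L in auto)

text \<open>Modularity enters the exchange argument here: that \<open>l, a, d\<close> are independent does not depend on
  the order in which they are listed.\<close>

lemma disjoint_rotate:
  assumes L: "a \<in> L" "d \<in> L" "l \<in> L" and "a \<^bold>\<sqinter> d = \<^bold>0" "l \<^bold>\<sqinter> (a \<^bold>\<squnion> d) = \<^bold>0"
  shows "a \<^bold>\<sqinter> (l \<^bold>\<squnion> d) = \<^bold>0"
proof -
  have "a \<^bold>\<sqinter> (l \<^bold>\<squnion> d) \<^bold>\<le> (a \<^bold>\<squnion> d) \<^bold>\<sqinter> (l \<^bold>\<squnion> d)"
    using L by (intro meet_mono join_upper1 le_refl join_closed)
  moreover have "(d \<^bold>\<squnion> l) \<^bold>\<sqinter> (a \<^bold>\<squnion> d) \<^bold>\<le> d \<^bold>\<squnion> l \<^bold>\<sqinter> (a \<^bold>\<squnion> d)"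
    using L by (intro modular join_upper2 join_closed)
  moreover have "(d \<^bold>\<squnion> l) \<^bold>\<sqinter> (a \<^bold>\<squnion> d) = (a \<^bold>\<squnion> d) \<^bold>\<sqinter> (l \<^bold>\<squnion> d)"
    using L by (metis join_commute meet_commute join_closed)
  ultimately have "a \<^bold>\<sqinter> (l \<^bold>\<squnion> d) \<^bold>\<le> d \<^bold>\<squnion> \<^bold>0"
    using L assms(5) le_trans[of "a \<^bold>\<sqinter> (l \<^bold>\<squnion> d)" "(a \<^bold>\<squnion> d) \<^bold>\<sqinter> (l \<^bold>\<squnion> d)" "d \<^bold>\<squnion> \<^bold>0"] by simp
  then have "a \<^bold>\<sqinter> (l \<^bold>\<squnion> d) \<^bold>\<le> d" using L by (simp add: join_bot)
  then have "a \<^bold>\<sqinter> (l \<^bold>\<squnion> d) \<^bold>\<le> a \<^bold>\<sqinter> d"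
    using L by (intro meet_greatest meet_lower1) auto
  then show ?thesis using L assms(4) by (intro le_bot) auto
qed

definition ess :: "'a \<Rightarrow> 'a \<Rightarrow> bool"
  where "ess a b \<longleftrightarrow> a \<^bold>\<le> b \<and> (\<forall>l\<in>L. l \<^bold>\<le> b \<longrightarrow> l \<^bold>\<sqinter> a = \<^bold>0 \<longrightarrow> l = \<^bold>0)"

lemma ess_le: "ess a b \<Longrightarrow> a \<^bold>\<le> b"
  by (simp add: ess_def)

lemma essD: "\<lbrakk>ess a b; l \<in> L; l \<^bold>\<le> b; l \<^bold>\<sqinter> a = \<^bold>0\<rbrakk> \<Longrightarrow> l = \<^bold>0"
  unfolding ess_def by blast

lemma ess_trans:
  assumes L: "a \<in> L" "b \<in> L" "c \<in> L" and ab: "ess a b" and bc: "ess b c"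
  shows "ess a c"
  unfolding ess_def
proof (intro conjI ballI impI)
  show "a \<^bold>\<le> c" using L ess_le[OF ab] ess_le[OF bc] by (rule le_trans)
  fix l assume l: "l \<in> L" "l \<^bold>\<le> c" "l \<^bold>\<sqinter> a = \<^bold>0"
  have "(l \<^bold>\<sqinter> b) \<^bold>\<sqinter> a = \<^bold>0"
    by (rule disjoint_mono[of _ l _ a]) (use L l in \<open>auto intro: meet_lower1 le_refl\<close>)
  then have "l \<^bold>\<sqinter> b = \<^bold>0"
    using L l essD[OF ab, of "l \<^bold>\<sqinter> b"] by (simp add: meet_lower2)
  then show "l = \<^bold>0" using l essD[OF bc] by simp
qed

lemma ess_mono:
  assumes L: "a \<in> L" "b \<in> L" "c \<in> L" and ac: "ess a c" and "a \<^bold>\<le> b" "b \<^bold>\<le> c"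
  shows "ess b c"
  unfolding ess_def
proof (intro conjI ballI impI)
  fix l assume l: "l \<in> L" "l \<^bold>\<le> c" "l \<^bold>\<sqinter> b = \<^bold>0"
  have "l \<^bold>\<sqinter> a = \<^bold>0"
    by (rule disjoint_mono[of _ l _ b]) (use assms l in \<open>auto intro: le_refl\<close>)
  then show "l = \<^bold>0" using l essD[OF ac] by simp
qed fact

text \<open>Adding an independent summand preserves essentiality. If \<open>l \<^bold>\<le> b \<^bold>\<squnion> d\<close> is disjoint from \<open>a \<^bold>\<squnion> d\<close>,
  then \<open>a\<close> is disjoint from \<open>l \<^bold>\<squnion> d\<close>; as \<open>a\<close> is essential in \<open>b\<close>, \<open>b\<close> is disjoint from \<open>l \<^bold>\<squnion> d\<close> as well, and modularity forces
  \<open>l \<^bold>\<le> d\<close>.\<close>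

lemma ess_join:
  assumes L: "a \<in> L" "b \<in> L" "d \<in> L" and ab: "ess a b" and bd: "b \<^bold>\<sqinter> d = \<^bold>0"
  shows "ess (a \<^bold>\<squnion> d) (b \<^bold>\<squnion> d)"
  unfolding ess_def
proof (intro conjI ballI impI)
  have le: "a \<^bold>\<le> b" using ab by (rule ess_le)
  show "a \<^bold>\<squnion> d \<^bold>\<le> b \<^bold>\<squnion> d" using L le by (intro join_mono le_refl)
  fix l assume l: "l \<in> L" "l \<^bold>\<le> b \<^bold>\<squnion> d" "l \<^bold>\<sqinter> (a \<^bold>\<squnion> d) = \<^bold>0"
  have "a \<^bold>\<sqinter> d = \<^bold>0"
    by (rule disjoint_mono[of _ b _ d]) (use L le bd in \<open>auto intro: le_refl\<close>)
  from L(1,3) l(1) this l(3) have "a \<^bold>\<sqinter> (l \<^bold>\<squnion> d) = \<^bold>0" by (rule disjoint_rotate)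
  then have "(l \<^bold>\<squnion> d) \<^bold>\<sqinter> a = \<^bold>0" using L l meet_commute[of a "l \<^bold>\<squnion> d"] by simp
  then have "((l \<^bold>\<squnion> d) \<^bold>\<sqinter> b) \<^bold>\<sqinter> a = \<^bold>0"
    using L l meet_lower1[of "l \<^bold>\<squnion> d" b] disjoint_mono[of "(l \<^bold>\<squnion> d) \<^bold>\<sqinter> b" "l \<^bold>\<squnion> d" a a]
    by (simp add: le_refl)
  then have z: "(l \<^bold>\<squnion> d) \<^bold>\<sqinter> b = \<^bold>0"
    using L l essD[OF ab, of "(l \<^bold>\<squnion> d) \<^bold>\<sqinter> b"] by (simp add: meet_lower2)
  have "(d \<^bold>\<squnion> b) \<^bold>\<sqinter> (l \<^bold>\<squnion> d) \<^bold>\<le> d \<^bold>\<squnion> b \<^bold>\<sqinter> (l \<^bold>\<squnion> d)"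
    using L l by (intro modular join_upper2) auto
  also have "b \<^bold>\<sqinter> (l \<^bold>\<squnion> d) = \<^bold>0"
    using z L l meet_commute[of b "l \<^bold>\<squnion> d"] by simp
  finally have "(d \<^bold>\<squnion> b) \<^bold>\<sqinter> (l \<^bold>\<squnion> d) \<^bold>\<le> d" using L by (simp add: join_bot)
  moreover have "l \<^bold>\<le> (d \<^bold>\<squnion> b) \<^bold>\<sqinter> (l \<^bold>\<squnion> d)"
    using L l join_commute[of b d] by (intro meet_greatest join_upper1) auto
  ultimately have "l \<^bold>\<le> d"
    using L l by (intro le_trans[of l "(d \<^bold>\<squnion> b) \<^bold>\<sqinter> (l \<^bold>\<squnion> d)" d]) auto
  then have "l \<^bold>\<le> a \<^bold>\<squnion> d"
    using L l join_upper2[of a d] by (intro le_trans[of l d "a \<^bold>\<squnion> d"]) auto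
  then show "l = \<^bold>0" using l L meet_absorb[of l "a \<^bold>\<squnion> d"] by simp
qed

text \<open>In the dual of a submodule lattice these are the submodules with hollow quotient.\<close>

definition uniform :: "'a \<Rightarrow> bool"
  where "uniform u \<longleftrightarrow> u \<noteq> \<^bold>0 \<and>
    (\<forall>a\<in>L. \<forall>b\<in>L. a \<^bold>\<le> u \<longrightarrow> b \<^bold>\<le> u \<longrightarrow> a \<^bold>\<sqinter> b = \<^bold>0 \<longrightarrow> a = \<^bold>0 \<or> b = \<^bold>0)"

definition joins :: "'a list \<Rightarrow> 'a"
  where "joins xs = foldr (\<^bold>\<squnion>) xs \<^bold>0"

lemma joins_simps [simp]:
  "joins [] = \<^bold>0" "joins (x # xs) = x \<^bold>\<squnion> joins xs"
  by (simp_all add: joins_def)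

lemma joins_closed [simp, intro]: "set xs \<subseteq> L \<Longrightarrow> joins xs \<in> L"
  by (induction xs) auto

lemma le_joins: "\<lbrakk>set xs \<subseteq> L; x \<in> set xs\<rbrakk> \<Longrightarrow> x \<^bold>\<le> joins xs"
proof (induction xs)
  case (Cons y ys)
  have "joins ys \<^bold>\<le> y \<^bold>\<squnion> joins ys" "y \<^bold>\<le> y \<^bold>\<squnion> joins ys"
    using Cons.prems by (auto intro: join_upper1 join_upper2)
  then show ?case using Cons le_trans[of x "joins ys" "y \<^bold>\<squnion> joins ys"] by auto
qed simp

lemma joins_least: "\<lbrakk>set xs \<subseteq> L; y \<in> L; \<And>x. x \<in> set xs \<Longrightarrow> x \<^bold>\<le> y\<rbrakk> \<Longrightarrow> joins xs \<^bold>\<le> y"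
  by (induction xs) (auto intro: bot_least join_least)

fun indep :: "'a list \<Rightarrow> bool" where
  "indep [] \<longleftrightarrow> True"
| "indep (x # xs) \<longleftrightarrow> x \<^bold>\<sqinter> joins xs = \<^bold>0 \<and> indep xs"

text \<open>The dimensions of a module ask each member of a family to be disjoint from the join of all the
  others; \<open>indep\<close> asks this only for the members that come later in a list, which is what
  induction along the list needs.\<close>

lemma indep_map:
  assumes ix: "distinct ix" "f ` set ix \<subseteq> L"
    and disj: "\<And>i. i \<in> set ix \<Longrightarrow> f i \<^bold>\<sqinter> joins (map f (filter (\<lambda>j. j \<noteq> i) ix)) = \<^bold>0"
  shows "indep (map f ix)"
proof -
  have "indep (map f ks)" if "distinct ks" "set ks \<subseteq> set ix" for ks
    using that
  proof (induction ks)
    case (Cons i ks)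
    let ?js = "filter (\<lambda>j. j \<noteq> i) ix"
    have L: "set (map f ks) \<subseteq> L" "set (map f ?js) \<subseteq> L" "f i \<in> L"
      using Cons.prems ix(2) by auto
    have "joins (map f ks) \<^bold>\<le> joins (map f ?js)"
    proof (rule joins_least[OF L(1)])
      fix x assume "x \<in> set (map f ks)"
      then have "x \<in> set (map f ?js)" using Cons.prems by auto
      then show "x \<^bold>\<le> joins (map f ?js)" by (rule le_joins[OF L(2)])
    qed (use L in auto)
    moreover have "f i \<^bold>\<sqinter> joins (map f ?js) = \<^bold>0" using Cons.prems by (intro disj) simp
    ultimately have "f i \<^bold>\<sqinter> joins (map f ks) = \<^bold>0"
      using disjoint_mono[of "f i" "f i" "joins (map f ks)" "joins (map f ?js)"] L
      by (simp add: le_refl)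
    then show ?case using Cons by simp
  qed simp
  then show ?thesis using ix(1) by simp
qed

definition finite_dim :: bool
  where "finite_dim \<longleftrightarrow>
    (\<exists>us. set us \<subseteq> L \<and> (\<forall>u\<in>set us. uniform u) \<and> indep us \<and> ess (joins us) \<^bold>1)"

text \<open>A nonzero element below a uniform \<open>u\<close> is essential in \<open>u\<close>, and a join of essential elements of
  independent elements is essential in their join. So an element that misses none of the \<open>u\<close>
  is essential below their join.\<close>

lemma ess_of_meets_uniforms:
  assumes "y \<in> L" "set us \<subseteq> L" "\<And>u. u \<in> set us \<Longrightarrow> uniform u" "indep us"
    and "\<And>u. u \<in> set us \<Longrightarrow> u \<^bold>\<sqinter> y \<noteq> \<^bold>0"
  shows "ess (y \<^bold>\<sqinter> joins us) (joins us)"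
  using assms(2-)
proof (induction us)
  case Nil
  have "l = \<^bold>0" if "l \<in> L" "l \<^bold>\<le> \<^bold>0" for l using that by (rule le_bot)
  then show ?case
    using \<open>y \<in> L\<close> meet_lower2[of y "\<^bold>0"] unfolding ess_def joins_simps by blast
next
  case (Cons u us)
  define j where "j = joins us"
  have L: "y \<in> L" "u \<in> L" "j \<in> L" using Cons.prems \<open>y \<in> L\<close> by (auto simp: j_def)
  have uj: "u \<^bold>\<sqinter> j = \<^bold>0" using Cons.prems by (simp add: j_def)
  have e: "ess (y \<^bold>\<sqinter> j) j" using Cons by (simp add: j_def)
  have "ess (u \<^bold>\<sqinter> y) u"
    unfolding ess_def
  proof (intro conjI ballI impI)
    show "u \<^bold>\<sqinter> y \<^bold>\<le> u" using L by (simp add: meet_lower1)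
    fix l assume "l \<in> L" "l \<^bold>\<le> u" "l \<^bold>\<sqinter> (u \<^bold>\<sqinter> y) = \<^bold>0"
    moreover have "uniform u" "u \<^bold>\<sqinter> y \<noteq> \<^bold>0" using Cons.prems by auto
    ultimately show "l = \<^bold>0"
      using L meet_lower1[of u y] unfolding uniform_def by blast
  qed
  moreover have "u \<^bold>\<sqinter> (y \<^bold>\<sqinter> j) = \<^bold>0"
    by (rule disjoint_mono[of u u _ j]) (use L uj in \<open>auto intro: meet_lower2 le_refl\<close>)
  ultimately have 1: "ess (u \<^bold>\<sqinter> y \<^bold>\<squnion> y \<^bold>\<sqinter> j) (u \<^bold>\<squnion> y \<^bold>\<sqinter> j)"
    using L by (intro ess_join) auto
  have 2: "ess (u \<^bold>\<squnion> y \<^bold>\<sqinter> j) (u \<^bold>\<squnion> j)"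
    using ess_join[OF _ _ _ e, of u] L uj by (simp add: join_commute meet_commute)
  have "ess (u \<^bold>\<sqinter> y \<^bold>\<squnion> y \<^bold>\<sqinter> j) (u \<^bold>\<squnion> j)"
    using ess_trans[OF _ _ _ 1 2] L by simp
  moreover have "u \<^bold>\<sqinter> y \<^bold>\<squnion> y \<^bold>\<sqinter> j \<^bold>\<le> y \<^bold>\<sqinter> (u \<^bold>\<squnion> j)"
  proof (rule join_least)
    show "u \<^bold>\<sqinter> y \<^bold>\<le> y \<^bold>\<sqinter> (u \<^bold>\<squnion> j)"
      using L meet_mono[of y y u "u \<^bold>\<squnion> j"] meet_commute[of u y] by (simp add: le_refl join_upper1)
    show "y \<^bold>\<sqinter> j \<^bold>\<le> y \<^bold>\<sqinter> (u \<^bold>\<squnion> j)"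
      using L by (intro meet_mono le_refl join_upper2) auto
  qed (use L in auto)
  ultimately have "ess (y \<^bold>\<sqinter> (u \<^bold>\<squnion> j)) (u \<^bold>\<squnion> j)"
    using L ess_mono[of "u \<^bold>\<sqinter> y \<^bold>\<squnion> y \<^bold>\<sqinter> j" "y \<^bold>\<sqinter> (u \<^bold>\<squnion> j)" "u \<^bold>\<squnion> j"] by (simp add: meet_lower2)
  then show ?case by (simp add: j_def)
qed

text \<open>The exchange argument: each step of the chain uses up a further one of the finitely many
  uniform elements.\<close>

lemma no_infinite_splitting:
  assumes fin: finite_dim
    and s: "\<And>j. s j \<in> L" "\<And>j. s (Suc j) \<^bold>\<le> s j"
    and split: "\<And>j::nat. \<exists>p\<in>L. p \<noteq> \<^bold>0 \<and> p \<^bold>\<le> s j \<and> p \<^bold>\<sqinter> s (Suc j) = \<^bold>0"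
  shows False
proof -
  obtain us where us: "set us \<subseteq> L" "\<And>u. u \<in> set us \<Longrightarrow> uniform u" "indep us" "ess (joins us) \<^bold>1"
    using fin by (auto simp: finite_dim_def)
  have "\<exists>qs. length qs = j \<and> distinct qs \<and> set qs \<subseteq> set us \<and> joins qs \<^bold>\<sqinter> s j = \<^bold>0" for j
  proof (induction j)
    case 0
    then show ?case
      using s(1)[of 0] meet_absorb[of "\<^bold>0" "s 0"] by (intro exI[of _ "[]"]) (simp add: bot_least)
  next
    case (Suc j)
    then obtain qs where qs: "length qs = j" "distinct qs" "set qs \<subseteq> set us"
        "joins qs \<^bold>\<sqinter> s j = \<^bold>0" by blast
    obtain p where p: "p \<in> L" "p \<noteq> \<^bold>0" "p \<^bold>\<le> s j" "p \<^bold>\<sqinter> s (Suc j) = \<^bold>0"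
      using split by blast
    define q where "q = joins qs"
    define d where "d = s (Suc j)"
    have L: "q \<in> L" "d \<in> L" using qs us(1) s by (auto simp: q_def d_def)
    \<comment> \<open>Both \<open>p\<close> and \<open>d\<close> lie below \<open>s j\<close>, so \<open>q\<close>, \<open>p\<close>, \<open>d\<close> are independent.\<close>
    have "q \<^bold>\<sqinter> (p \<^bold>\<squnion> d) = \<^bold>0"
      by (rule disjoint_mono[of q q _ "s j"]) (use L p s qs(4) in \<open>auto intro: join_least le_refl simp: q_def d_def\<close>)
    then have pq: "p \<^bold>\<sqinter> (q \<^bold>\<squnion> d) = \<^bold>0"
      using L p disjoint_rotate[of p d q] by (simp add: d_def)
    have "\<exists>u\<in>set us. u \<^bold>\<sqinter> (q \<^bold>\<squnion> d) = \<^bold>0"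
    proof (rule ccontr)
      assume "\<not> ?thesis"
      then have "ess ((q \<^bold>\<squnion> d) \<^bold>\<sqinter> joins us) (joins us)"
        using us L by (intro ess_of_meets_uniforms) auto
      then have "ess ((q \<^bold>\<squnion> d) \<^bold>\<sqinter> joins us) \<^bold>1"
        using us(1,4) L ess_trans[of "(q \<^bold>\<squnion> d) \<^bold>\<sqinter> joins us" "joins us" "\<^bold>1"] by simp
      then have "ess (q \<^bold>\<squnion> d) \<^bold>1"
        using us(1) L ess_mono[of "(q \<^bold>\<squnion> d) \<^bold>\<sqinter> joins us" "q \<^bold>\<squnion> d" "\<^bold>1"]
        by (simp add: meet_lower1 top_greatest)
      from essD[OF this p(1) top_greatest[OF p(1)] pq] p(2) show False by contradiction
    qed
    then obtain u where u: "u \<in> set us" "u \<^bold>\<sqinter> (q \<^bold>\<squnion> d) = \<^bold>0" by blast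
    have uL: "u \<in> L" using u us by auto
    have "u \<^bold>\<sqinter> q = \<^bold>0"
      by (rule disjoint_mono[of u u q "q \<^bold>\<squnion> d"]) (use u L uL in \<open>auto intro: le_refl join_upper1\<close>)
    moreover have "u \<noteq> \<^bold>0" using us u by (auto simp: uniform_def)
    ultimately have "u \<notin> set qs"
      using le_joins[of qs u] meet_absorb[of u q] qs us(1) uL L by (auto simp: q_def)
    have "q \<^bold>\<sqinter> d = \<^bold>0"
      by (rule disjoint_mono[of q q d "s j"]) (use qs L s in \<open>auto intro: le_refl simp: q_def d_def\<close>)
    then have "d \<^bold>\<sqinter> (u \<^bold>\<squnion> q) = \<^bold>0"
      using u(2) L uL disjoint_rotate[of d q u] join_commute[of q d] meet_commute[of q d] by simp
    then have "joins (u # qs) \<^bold>\<sqinter> s (Suc j) = \<^bold>0"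
      using L uL by (simp add: q_def d_def meet_commute)
    then show ?case using qs u \<open>u \<notin> set qs\<close> by (intro exI[of _ "u # qs"]) auto
  qed
  from this[of "Suc (length us)"] obtain qs
    where "length qs = Suc (length us)" "distinct qs" "set qs \<subseteq> set us" by blast
  then show False
    using card_mono[of "set us" "set qs"] card_length[of us] by (simp add: distinct_card)
qed

text \<open>The hypotheses are almost self-dual: exchanging \<open>P\<close> and \<open>N\<close> reverses the order. For the second
  components the splitting element is \<open>p\<close> itself; dually, for the first components, it is the
  element \<open>P\<^sub>j \<^bold>\<squnion> N\<^bsub>j+1\<^esub>\<close>, which \<open>P\<^bsub>j+1\<^esub>\<close> completes to the top element.\<close>

lemma no_infinite_complement_sequence:
  assumes fin: "finite_dim \<or> bounded_modular_lattice.finite_dim L (\<lambda>x y. y \<^bold>\<le> x) (\<^bold>\<sqinter>) (\<^bold>\<squnion>) \<^bold>1 \<^bold>0"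
    and L: "\<And>j::nat. P j \<in> L" "\<And>j. N j \<in> L"
    and compl: "\<And>j. P j \<^bold>\<sqinter> N j = \<^bold>0" "\<And>j. P j \<^bold>\<squnion> N j = \<^bold>1"
    and step: "\<And>j. \<exists>p\<in>L. p \<noteq> \<^bold>0 \<and> P (Suc j) = P j \<^bold>\<squnion> p \<and> N j = p \<^bold>\<squnion> N (Suc j) \<and> p \<^bold>\<sqinter> N (Suc j) = \<^bold>0"
  shows False
  using fin
proof
  assume finite_dim
  then show False
  proof (rule no_infinite_splitting[of N])
    fix j
    obtain p where p: "p \<in> L" "p \<noteq> \<^bold>0" "N j = p \<^bold>\<squnion> N (Suc j)" "p \<^bold>\<sqinter> N (Suc j) = \<^bold>0"
      using step by blast
    show "N (Suc j) \<^bold>\<le> N j" using p L join_upper2 by simp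
    show "\<exists>p\<in>L. p \<noteq> \<^bold>0 \<and> p \<^bold>\<le> N j \<and> p \<^bold>\<sqinter> N (Suc j) = \<^bold>0"
      using p L join_upper1 by auto
  qed (rule L)
next
  interpret D: bounded_modular_lattice L "\<lambda>x y. y \<^bold>\<le> x" "(\<^bold>\<sqinter>)" "(\<^bold>\<squnion>)" "\<^bold>1" "\<^bold>0"
    by (rule dual)
  assume D.finite_dim
  then show False
  proof (rule D.no_infinite_splitting[of P])
    fix j
    obtain p where p: "p \<in> L" "p \<noteq> \<^bold>0" "P (Suc j) = P j \<^bold>\<squnion> p" "N j = p \<^bold>\<squnion> N (Suc j)"
      using step by blast
    show PS: "P j \<^bold>\<le> P (Suc j)" using p L join_upper1 by simp
    define q where "q = P j \<^bold>\<squnion> N (Suc j)"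
    have q: "q \<in> L" using L by (simp add: q_def)
    have "q \<^bold>\<squnion> P (Suc j) = \<^bold>1"
    proof (rule le_antisym)
      have "N (Suc j) \<^bold>\<le> q" using L by (simp add: q_def join_upper2)
      then have "N (Suc j) \<^bold>\<le> q \<^bold>\<squnion> P (Suc j)"
        using L q le_trans[of "N (Suc j)" q "q \<^bold>\<squnion> P (Suc j)"] by (simp add: join_upper1)
      then have "P (Suc j) \<^bold>\<squnion> N (Suc j) \<^bold>\<le> q \<^bold>\<squnion> P (Suc j)"
        using L q by (intro join_least join_upper2) auto
      then show "\<^bold>1 \<^bold>\<le> q \<^bold>\<squnion> P (Suc j)" using compl by simp
    qed (use L q in \<open>auto intro: top_greatest\<close>)
    moreover have "P j \<^bold>\<le> q" using L by (simp add: q_def join_upper1)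
    \<comment> \<open>By modularity \<open>q\<close> meets \<open>P (Suc j)\<close> in \<open>P j\<close>; if \<open>q\<close> were the top element, \<open>p\<close> would lie in \<open>P j\<close>.\<close>
    moreover have "q \<noteq> \<^bold>1"
    proof
      assume "q = \<^bold>1"
      have "q \<^bold>\<sqinter> P (Suc j) \<^bold>\<le> P j \<^bold>\<squnion> N (Suc j) \<^bold>\<sqinter> P (Suc j)"
        unfolding q_def using L PS by (intro modular)
      also have "N (Suc j) \<^bold>\<sqinter> P (Suc j) = \<^bold>0" using compl L by (simp add: meet_commute)
      finally have "P (Suc j) \<^bold>\<le> P j \<^bold>\<squnion> \<^bold>0"
        using \<open>q = \<^bold>1\<close> L meet_absorb[of "P (Suc j)" "\<^bold>1"] by (simp add: meet_commute top_greatest)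
      then have "P (Suc j) \<^bold>\<le> P j" using L by (simp add: join_bot)
      moreover have "p \<^bold>\<le> P (Suc j)" "p \<^bold>\<le> N j" using p L by (auto intro: join_upper1 join_upper2)
      ultimately have "p \<^bold>\<le> P j \<^bold>\<sqinter> N j"
        using L p(1) le_trans[of p "P (Suc j)" "P j"] by (simp add: meet_greatest)
      then show False using p(1,2) compl(1)[of j] le_bot[of p] by simp
    qed
    ultimately show "\<exists>q\<in>L. q \<noteq> \<^bold>1 \<and> P j \<^bold>\<le> q \<and> q \<^bold>\<squnion> P (Suc j) = \<^bold>1"
      using q by blast
  qed (rule L)
qed

end

section \<open>The lattice of submodules\<close>

lemma set_addI: "\<lbrakk>a \<in> A; b \<in> B\<rbrakk> \<Longrightarrow> a \<oplus>\<^bsub>M\<^esub> b \<in> A <+>\<^bsub>M\<^esub> B"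
  unfolding set_add_def' by blast

context right_module
begin

lemma smult_minus_one:
  assumes x: "x \<in> carrier M" shows "x \<cdot>\<^bsub>M\<^esub> (\<ominus>\<^bsub>R\<^esub> \<one>\<^bsub>R\<^esub>) = \<ominus>\<^bsub>M\<^esub> x"
proof -
  have "x \<cdot>\<^bsub>M\<^esub> (\<ominus>\<^bsub>R\<^esub> \<one>\<^bsub>R\<^esub>) \<oplus>\<^bsub>M\<^esub> x = x \<cdot>\<^bsub>M\<^esub> (\<ominus>\<^bsub>R\<^esub> \<one>\<^bsub>R\<^esub>) \<oplus>\<^bsub>M\<^esub> x \<cdot>\<^bsub>M\<^esub> \<one>\<^bsub>R\<^esub>" using x by simp
  also have "\<dots> = x \<cdot>\<^bsub>M\<^esub> (\<ominus>\<^bsub>R\<^esub> \<one>\<^bsub>R\<^esub> \<oplus>\<^bsub>R\<^esub> \<one>\<^bsub>R\<^esub>)"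
    using smult_add_scalar[of x "\<ominus>\<^bsub>R\<^esub> \<one>\<^bsub>R\<^esub>" "\<one>\<^bsub>R\<^esub>"] x by simp
  also have "\<dots> = \<zero>\<^bsub>M\<^esub>" using x by (simp add: R.l_neg)
  finally show ?thesis using x by (intro M.minus_equality[symmetric]) auto
qed

text \<open>Closure under negation comes for free, as negation is multiplication by \<open>-1\<close>.\<close>

lemma submodule_iff:
  "submodule N R M \<longleftrightarrow> N \<subseteq> carrier M \<and> \<zero>\<^bsub>M\<^esub> \<in> N \<and> (\<forall>x\<in>N. \<forall>y\<in>N. x \<oplus>\<^bsub>M\<^esub> y \<in> N) \<and>
    (\<forall>x\<in>N. \<forall>a\<in>carrier R. x \<cdot>\<^bsub>M\<^esub> a \<in> N)" (is "_ \<longleftrightarrow> ?r")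
proof
  assume "submodule N R M"
  then interpret N: submodule N R M .
  show ?r using N.subset N.one_closed N.m_closed N.smult_closed by auto
next
  assume r: ?r
  have "\<ominus>\<^bsub>M\<^esub> x \<in> N" if "x \<in> N" for x
  proof -
    have "x \<cdot>\<^bsub>M\<^esub> (\<ominus>\<^bsub>R\<^esub> \<one>\<^bsub>R\<^esub>) \<in> N" "x \<in> carrier M" using r that by auto
    then show ?thesis by (simp add: smult_minus_one)
  qed
  then show "submodule N R M"
    using r unfolding submodule_def submodule_axioms_def subgroup_def a_inv_def by auto
qed

lemma submoduleD:
  assumes "submodule N R M"
  shows "x \<in> N \<Longrightarrow> x \<in> carrier M" "\<zero>\<^bsub>M\<^esub> \<in> N"
    "x \<in> N \<Longrightarrow> y \<in> N \<Longrightarrow> x \<oplus>\<^bsub>M\<^esub> y \<in> N" "x \<in> N \<Longrightarrow> a \<in> carrier R \<Longrightarrow> x \<cdot>\<^bsub>M\<^esub> a \<in> N"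
    "x \<in> N \<Longrightarrow> \<ominus>\<^bsub>M\<^esub> x \<in> N"
proof -
  show "\<ominus>\<^bsub>M\<^esub> x \<in> N" if "x \<in> N"
    using assms that subgroup.m_inv_closed[of N "add_monoid M"]
    by (simp add: submodule_def a_inv_def)
qed (use assms in \<open>auto simp: submodule_iff\<close>)

lemma submodule_sub_mod_iff:
  assumes U: "submodule U R M"
  shows "submodule N R (sub_mod M U) \<longleftrightarrow> submodule N R M \<and> N \<subseteq> U"
proof -
  interpret U: right_module R "sub_mod M U"
    by (rule right_module_sub_mod[OF right_module_axioms U])
  show ?thesis using submoduleD(1)[OF U] by (auto simp: U.submodule_iff submodule_iff)
qed

lemma submodule_zero: "submodule {\<zero>\<^bsub>M\<^esub>} R M"
  by (simp add: submodule_iff)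

lemma submodule_carrier: "submodule (carrier M) R M"
  by (simp add: submodule_iff)

lemma submodule_set_add:
  assumes A: "submodule A R M" and B: "submodule B R M"
  shows "submodule (A <+>\<^bsub>M\<^esub> B) R M"
  unfolding submodule_iff
proof (intro conjI ballI)
  show "A <+>\<^bsub>M\<^esub> B \<subseteq> carrier M"
    using submoduleD(1)[OF A] submoduleD(1)[OF B] by (auto simp: set_add_def')
  show "\<zero>\<^bsub>M\<^esub> \<in> A <+>\<^bsub>M\<^esub> B"
    using set_addI[OF submoduleD(2)[OF A] submoduleD(2)[OF B], of M] by simp
next
  fix x y assume "x \<in> A <+>\<^bsub>M\<^esub> B" "y \<in> A <+>\<^bsub>M\<^esub> B"
  then obtain a b a' b' where *: "a \<in> A" "b \<in> B" "x = a \<oplus>\<^bsub>M\<^esub> b" "a' \<in> A" "b' \<in> B" "y = a' \<oplus>\<^bsub>M\<^esub> b'"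
    by (auto simp: set_add_def')
  then have "x \<oplus>\<^bsub>M\<^esub> y = (a \<oplus>\<^bsub>M\<^esub> a') \<oplus>\<^bsub>M\<^esub> (b \<oplus>\<^bsub>M\<^esub> b')"
    using submoduleD(1)[OF A] submoduleD(1)[OF B] by (simp add: M.a_ac)
  then show "x \<oplus>\<^bsub>M\<^esub> y \<in> A <+>\<^bsub>M\<^esub> B"
    using * submoduleD(3)[OF A] submoduleD(3)[OF B] by (simp add: set_addI)
next
  fix x r assume "x \<in> A <+>\<^bsub>M\<^esub> B" and r: "r \<in> carrier R"
  then obtain a b where *: "a \<in> A" "b \<in> B" "x = a \<oplus>\<^bsub>M\<^esub> b" by (auto simp: set_add_def')
  then have "x \<cdot>\<^bsub>M\<^esub> r = a \<cdot>\<^bsub>M\<^esub> r \<oplus>\<^bsub>M\<^esub> b \<cdot>\<^bsub>M\<^esub> r"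
    using r submoduleD(1)[OF A] submoduleD(1)[OF B] by (simp add: smult_add_vector)
  then show "x \<cdot>\<^bsub>M\<^esub> r \<in> A <+>\<^bsub>M\<^esub> B"
    using * r submoduleD(4)[OF A] submoduleD(4)[OF B] by (simp add: set_addI)
qed

lemma subset_set_add:
  assumes A: "submodule A R M" and B: "submodule B R M"
  shows "A \<subseteq> A <+>\<^bsub>M\<^esub> B" "B \<subseteq> A <+>\<^bsub>M\<^esub> B"
proof -
  show "A \<subseteq> A <+>\<^bsub>M\<^esub> B"
  proof
    fix x assume "x \<in> A"
    then show "x \<in> A <+>\<^bsub>M\<^esub> B"
      using set_addI[OF _ submoduleD(2)[OF B], of x A M] submoduleD(1)[OF A] by simp
  qed
  show "B \<subseteq> A <+>\<^bsub>M\<^esub> B"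
  proof
    fix x assume "x \<in> B"
    then show "x \<in> A <+>\<^bsub>M\<^esub> B"
      using set_addI[OF submoduleD(2)[OF A], of x B M] submoduleD(1)[OF B] by simp
  qed
qed

lemma submodule_lattice:
  "bounded_modular_lattice {N. submodule N R M} (\<subseteq>) (set_add M) (\<inter>) {\<zero>\<^bsub>M\<^esub>} (carrier M)"
proof (unfold_locales, goal_cases)
  case (2 A B)
  then show ?case by (auto simp: submodule_iff)
next
  case (10 A B C)
  then show ?case using submoduleD(3)[of C] unfolding set_add_def' by blast
next
  case (16 A B C)
  then have sub: "submodule A R M" "submodule B R M" "submodule C R M" by simp_all
  have "b \<in> C" if "a \<in> A" "b \<in> B" "a \<oplus>\<^bsub>M\<^esub> b \<in> C" for a b
  proof -
    have "b = \<ominus>\<^bsub>M\<^esub> a \<oplus>\<^bsub>M\<^esub> (a \<oplus>\<^bsub>M\<^esub> b)"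
      using that submoduleD(1)[OF sub(1)] submoduleD(1)[OF sub(2)] by (simp add: M.r_neg1)
    moreover have "\<ominus>\<^bsub>M\<^esub> a \<in> C" using that 16 submoduleD(5)[OF sub(3)] by blast
    ultimately show ?thesis
      using submoduleD(3)[OF sub(3), of "\<ominus>\<^bsub>M\<^esub> a" "a \<oplus>\<^bsub>M\<^esub> b"] that(3) by simp
  qed
  then show ?case unfolding set_add_def' by blast
next
  case (14 A)
  then show ?case by (simp add: submodule_iff)
next
  case (15 A)
  then show ?case by (simp add: submodule_iff)
qed (simp_all add: submodule_set_add submodule_zero submodule_carrier subset_set_add)

interpretation S: bounded_modular_lattice
    "{N. submodule N R M}" "(\<subseteq>)" "set_add M" "(\<inter>)" "{\<zero>\<^bsub>M\<^esub>}" "carrier M"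
  by (rule submodule_lattice)

interpretation D: bounded_modular_lattice
    "{N. submodule N R M}" "\<lambda>A B. B \<subseteq> A" "(\<inter>)" "set_add M" "carrier M" "{\<zero>\<^bsub>M\<^esub>}"
  by (rule S.dual)

lemma uniform_submodule:
  assumes U: "submodule U R M" and uni: "uniform_module R (sub_mod M U)"
  shows "S.uniform U"
  unfolding S.uniform_def
proof (intro conjI ballI impI)
  show "U \<noteq> {\<zero>\<^bsub>M\<^esub>}" using uni by (simp add: uniform_module_def)
  fix A B assume *: "A \<in> {N. submodule N R M}" "B \<in> {N. submodule N R M}" "A \<subseteq> U" "B \<subseteq> U"
      "A \<inter> B = {\<zero>\<^bsub>M\<^esub>}"
  then have "submodule A R (sub_mod M U)" "submodule B R (sub_mod M U)"
    using submodule_sub_mod_iff[OF U] by auto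
  then show "A = {\<zero>\<^bsub>M\<^esub>} \<or> B = {\<zero>\<^bsub>M\<^esub>}"
    using uni *(5) by (auto simp: uniform_module_def essential_def)
qed

lemma submod_sum_empty: "submod_sum M U {} = {\<zero>\<^bsub>M\<^esub>}"
  by (simp add: submod_sum_def)

lemma submod_sum_insert:
  assumes I: "finite I" "i \<notin> I" and U: "\<And>j. j \<in> insert i I \<Longrightarrow> U j \<subseteq> carrier M"
  shows "submod_sum M U (insert i I) = U i <+>\<^bsub>M\<^esub> submod_sum M U I"
proof (intro equalityI subsetI)
  fix x assume "x \<in> submod_sum M U (insert i I)"
  then obtain u where u: "u \<in> Pi (insert i I) U" "x = (\<Oplus>\<^bsub>M\<^esub>j\<in>insert i I. u j)"
    by (auto simp: submod_sum_def)
  then have "x = u i \<oplus>\<^bsub>M\<^esub> (\<Oplus>\<^bsub>M\<^esub>j\<in>I. u j)"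
    using I U by (subst (asm) M.finsum_insert) (auto simp: Pi_def)
  moreover have "u i \<in> U i" "(\<Oplus>\<^bsub>M\<^esub>j\<in>I. u j) \<in> submod_sum M U I"
    using u by (auto simp: submod_sum_def)
  ultimately show "x \<in> U i <+>\<^bsub>M\<^esub> submod_sum M U I" by (simp add: set_addI)
next
  fix x assume "x \<in> U i <+>\<^bsub>M\<^esub> submod_sum M U I"
  then obtain a u where au: "a \<in> U i" "u \<in> Pi I U" "x = a \<oplus>\<^bsub>M\<^esub> (\<Oplus>\<^bsub>M\<^esub>j\<in>I. u j)"
    by (auto simp: submod_sum_def set_add_def')
  have aM: "a \<in> carrier M" and uM: "\<And>j. j \<in> I \<Longrightarrow> u j \<in> carrier M" using au(1,2) U by blast+
  let ?v = "u(i := a)"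
  have v: "?v \<in> Pi (insert i I) U" using au by auto
  have "(\<Oplus>\<^bsub>M\<^esub>j\<in>insert i I. ?v j) = ?v i \<oplus>\<^bsub>M\<^esub> (\<Oplus>\<^bsub>M\<^esub>j\<in>I. ?v j)"
    using I aM uM by (intro M.finsum_insert) auto
  also have "(\<Oplus>\<^bsub>M\<^esub>j\<in>I. ?v j) = (\<Oplus>\<^bsub>M\<^esub>j\<in>I. u j)"
    using I uM by (intro M.finsum_cong') auto
  finally have "x = (\<Oplus>\<^bsub>M\<^esub>j\<in>insert i I. ?v j)" using au(3) by simp
  then show "x \<in> submod_sum M U (insert i I)"
    using v unfolding submod_sum_def by blast
qed

lemma joins_eq_submod_sum:
  assumes "distinct ix" "\<And>i. i \<in> set ix \<Longrightarrow> submodule (U i) R M"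
  shows "S.joins (map U ix) = submod_sum M U (set ix)"
  using assms
proof (induction ix)
  case (Cons i ix)
  moreover have "U j \<subseteq> carrier M" if "j \<in> set (i # ix)" for j
    using submoduleD(1) Cons.prems(2)[OF that] by blast
  ultimately show ?case using submod_sum_insert[of "set ix" i U] by simp
qed (simp add: submod_sum_empty)

lemma joins_dual_eq_submod_Int: "D.joins (map K ix) = submod_Int M K (set ix)"
  by (induction ix) (auto simp: submod_Int_def)

lemma finite_dim_of_has_udim:
  assumes "has_udim R M n"
  shows "S.finite_dim"
proof -
  obtain U where U: "\<And>i. i \<in> {1..n} \<Longrightarrow> submodule (U i) R M"
      "\<And>i. i \<in> {1..n} \<Longrightarrow> uniform_module R (sub_mod M (U i))"
      "\<And>i. i \<in> {1..n} \<Longrightarrow> U i \<inter> submod_sum M U ({1..n} - {i}) = {\<zero>\<^bsub>M\<^esub>}"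
      "essential R M (submod_sum M U {1..n})"
    using assms unfolding has_udim_def by blast
  let ?ix = "[1..<Suc n]"
  have ix: "distinct ?ix" "set ?ix = {1..n}" by auto
  have sum: "S.joins (map U ks) = submod_sum M U (set ks)" if "distinct ks" "set ks \<subseteq> {1..n}" for ks
    using that U(1) by (intro joins_eq_submod_sum) auto
  show ?thesis
    unfolding S.finite_dim_def
  proof (intro exI conjI)
    show "set (map U ?ix) \<subseteq> {N. submodule N R M}" using U(1) ix(2) by auto
    show "\<forall>u\<in>set (map U ?ix). S.uniform u" using U(1,2) ix(2) uniform_submodule by auto
    show "S.indep (map U ?ix)"
    proof (rule S.indep_map[OF ix(1)])
      fix i assume i: "i \<in> set ?ix"
      let ?js = "filter (\<lambda>j. j \<noteq> i) ?ix"
      have "set ?js = {1..n} - {i}" using ix(2) by auto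
      then show "U i \<inter> S.joins (map U ?js) = {\<zero>\<^bsub>M\<^esub>}"
        using sum[of ?js] U(3)[of i] i ix by (simp del: upt_Suc)
    qed (use U(1) ix(2) in auto)
    show "S.ess (S.joins (map U ?ix)) (carrier M)"
      using sum[of ?ix] ix U(4) S.top_greatest[of "submod_sum M U {1..n}"]
      by (auto simp: S.ess_def essential_def Int_commute simp del: upt_Suc)
  qed
qed

text \<open>Submodules above \<open>K\<close> correspond to submodules of the quotient by \<open>K\<close>, and this correspondence
  respects sums. So two submodules above \<open>K\<close> with sum \<open>M\<close> have images whose sum is the quotient,
  and hollowness makes one of the images, hence one of the submodules, everything.\<close>

lemma dual_uniform_of_hollow:
  assumes K: "submodule K R M" "K \<noteq> carrier M" and hol: "hollow_module R (quot_mod M K)"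
  shows "D.uniform K"
proof -
  let ?Q = "quot_mod M K"
  interpret Q: right_module R ?Q by (rule right_module_quot_mod[OF right_module_axioms K(1)])
  interpret K: submodule K R M by (rule K(1))
  interpret K: abelian_subgroup K M
    by (intro abelian_subgroupI3 additive_subgroup.intro K.subgroup_axioms M.abelian_group_axioms)
  have car: "carrier ?Q = (\<lambda>x. K +>\<^bsub>M\<^esub> x) ` carrier M"
    by (auto simp: quot_mod_def A_RCOSETS_def')
  have zero: "\<zero>\<^bsub>?Q\<^esub> = K +>\<^bsub>M\<^esub> \<zero>\<^bsub>M\<^esub>"
    using K.a_subset by (simp add: quot_mod_def)
  have add: "(K +>\<^bsub>M\<^esub> x) \<oplus>\<^bsub>?Q\<^esub> (K +>\<^bsub>M\<^esub> y) = K +>\<^bsub>M\<^esub> (x \<oplus>\<^bsub>M\<^esub> y)"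
    if "x \<in> carrier M" "y \<in> carrier M" for x y
    using that by (simp add: quot_mod_def K.a_rcos_sum)
  have sm: "(K +>\<^bsub>M\<^esub> x) \<cdot>\<^bsub>?Q\<^esub> a = K +>\<^bsub>M\<^esub> (x \<cdot>\<^bsub>M\<^esub> a)"
    if x: "x \<in> carrier M" and a: "a \<in> carrier R" for x a
  proof -
    have "(K +>\<^bsub>M\<^esub> x) \<cdot>\<^bsub>?Q\<^esub> a \<in> carrier ?Q" using x a car by (intro Q.smult_closed) auto
    then obtain y where y: "y \<in> carrier M" "(K +>\<^bsub>M\<^esub> x) \<cdot>\<^bsub>?Q\<^esub> a = K +>\<^bsub>M\<^esub> y"
      unfolding car by blast
    \<comment> \<open>The left-hand side is a coset, so it is determined by any one of its elements.\<close>
    have "x \<cdot>\<^bsub>M\<^esub> a \<in> (K +>\<^bsub>M\<^esub> x) \<cdot>\<^bsub>?Q\<^esub> a"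
      using K.a_rcos_self[OF x] K.a_rcos_self[of "x \<cdot>\<^bsub>M\<^esub> a"] x a by (auto simp: quot_mod_def)
    then show ?thesis
      using y K.a_repr_independence'[of "x \<cdot>\<^bsub>M\<^esub> a" y] by simp
  qed
  have quot: "submodule ((\<lambda>x. K +>\<^bsub>M\<^esub> x) ` A) R ?Q" if A: "submodule A R M" for A
    unfolding Q.submodule_iff
  proof (intro conjI ballI)
    show "(\<lambda>x. K +>\<^bsub>M\<^esub> x) ` A \<subseteq> carrier ?Q" using submoduleD(1)[OF A] by (auto simp: car)
    show "\<zero>\<^bsub>?Q\<^esub> \<in> (\<lambda>x. K +>\<^bsub>M\<^esub> x) ` A" using submoduleD(2)[OF A] by (auto simp: zero)
  qed (use submoduleD[OF A] in \<open>auto simp: add sm\<close>)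
  have full: "A = carrier M"
    if A: "submodule A R M" "K \<subseteq> A" and eq: "(\<lambda>x. K +>\<^bsub>M\<^esub> x) ` A = carrier ?Q" for A
  proof
    show "A \<subseteq> carrier M" using submoduleD(1)[OF A(1)] by auto
    show "carrier M \<subseteq> A"
    proof
      fix x assume x: "x \<in> carrier M"
      then obtain a where "a \<in> A" "K +>\<^bsub>M\<^esub> x = K +>\<^bsub>M\<^esub> a" using eq unfolding car by blast
      then have "x \<in> K +>\<^bsub>M\<^esub> a" using K.a_rcos_self[OF x] by simp
      then show "x \<in> A" using \<open>a \<in> A\<close> A submoduleD(3)[OF A(1)] by (auto simp: a_r_coset_def')
    qed
  qed
  show ?thesis
    unfolding D.uniform_def
  proof (intro conjI ballI impI K(2))
    fix A B assume *: "A \<in> {N. submodule N R M}" "B \<in> {N. submodule N R M}" "K \<subseteq> A" "K \<subseteq> B"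
      "A <+>\<^bsub>M\<^esub> B = carrier M"
    then have A: "submodule A R M" and B: "submodule B R M" by simp_all
    let ?qA = "(\<lambda>x. K +>\<^bsub>M\<^esub> x) ` A" and ?qB = "(\<lambda>x. K +>\<^bsub>M\<^esub> x) ` B"
    have "?qA <+>\<^bsub>?Q\<^esub> ?qB = carrier ?Q"
    proof (intro equalityI subsetI)
      fix X assume "X \<in> ?qA <+>\<^bsub>?Q\<^esub> ?qB"
      then show "X \<in> carrier ?Q"
        using submoduleD(1)[OF A] submoduleD(1)[OF B] by (auto simp: set_add_def' add car)
    next
      fix X assume "X \<in> carrier ?Q"
      then obtain x where "x \<in> A <+>\<^bsub>M\<^esub> B" "X = K +>\<^bsub>M\<^esub> x" unfolding car *(5) by blast
      then obtain a b where "a \<in> A" "b \<in> B" "X = K +>\<^bsub>M\<^esub> (a \<oplus>\<^bsub>M\<^esub> b)" by (auto simp: set_add_def')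
      then show "X \<in> ?qA <+>\<^bsub>?Q\<^esub> ?qB"
        using add[symmetric, of a b] submoduleD(1)[OF A] submoduleD(1)[OF B]
        by (auto simp: set_add_def')
    qed
    then have "?qA = carrier ?Q \<or> ?qB = carrier ?Q"
      using hol quot[OF A] quot[OF B] unfolding hollow_module_def superfluous_def by blast
    then show "A = carrier M \<or> B = carrier M" using full A B *(3,4) by blast
  qed
qed

lemma dual_finite_dim_of_has_hdim:
  assumes "has_hdim R M n"
  shows "D.finite_dim"
proof -
  obtain K where K: "\<And>i. i \<in> {1..n} \<Longrightarrow> submodule (K i) R M"
      "\<And>i. i \<in> {1..n} \<Longrightarrow> K i \<noteq> carrier M"
      "\<And>i. i \<in> {1..n} \<Longrightarrow> hollow_module R (quot_mod M (K i))"
      "\<And>i. i \<in> {1..n} \<Longrightarrow> K i <+>\<^bsub>M\<^esub> submod_Int M K ({1..n} - {i}) = carrier M"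
      "superfluous R M (submod_Int M K {1..n})"
    using assms unfolding has_hdim_def by blast
  let ?ix = "[1..<Suc n]"
  have ix: "distinct ?ix" "set ?ix = {1..n}" by auto
  show ?thesis
    unfolding D.finite_dim_def
  proof (intro exI conjI)
    show "set (map K ?ix) \<subseteq> {N. submodule N R M}" using K(1) ix(2) by auto
    show "\<forall>u\<in>set (map K ?ix). D.uniform u" using K(1-3) ix(2) dual_uniform_of_hollow by auto
    show "D.indep (map K ?ix)"
    proof (rule D.indep_map[OF ix(1)])
      fix i assume i: "i \<in> set ?ix"
      let ?js = "filter (\<lambda>j. j \<noteq> i) ?ix"
      have js: "set ?js = {1..n} - {i}" using ix(2) by auto
      show "K i <+>\<^bsub>M\<^esub> D.joins (map K ?js) = carrier M"
        unfolding joins_dual_eq_submod_Int js using K(4) i ix(2) by blast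
    qed (use K(1) ix(2) in auto)
    have "submod_Int M K {1..n} <+>\<^bsub>M\<^esub> L = L <+>\<^bsub>M\<^esub> submod_Int M K {1..n}" if "submodule L R M" for L
      using K(5) that by (intro S.join_commute) (auto simp: superfluous_def)
    then show "D.ess (D.joins (map K ?ix)) {\<zero>\<^bsub>M\<^esub>}"
      using ix K(5) S.bot_least[of "submod_Int M K {1..n}"]
      by (auto simp: D.ess_def superfluous_def joins_dual_eq_submod_Int simp del: upt_Suc)
  qed
qed

end

section \<open>Projective submodules\<close>

lemma right_hom_zero:
  assumes "right_module R A" "right_module R B" "f \<in> right_hom R A B"
  shows "f \<zero>\<^bsub>A\<^esub> = \<zero>\<^bsub>B\<^esub>"
proof -
  interpret A: right_module R A by fact
  interpret B: right_module R B by fact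
  show ?thesis using right_hom_finsum[OF assms, of "{}" "\<lambda>_. \<zero>\<^bsub>A\<^esub>"] by simp
qed

context right_module
begin

lemma projective_zero: "projective_module R (sub_mod M {\<zero>\<^bsub>M\<^esub>})"
  unfolding projective_module_def
proof (intro allI impI, elim conjE)
  fix A :: "('r, 'm \<Rightarrow> 'r) module" and B :: "('r, 'm) module" and g f
  assume A: "right_module R A" and B: "right_module R B" and g: "g \<in> right_hom R A B"
    and f: "f \<in> right_hom R (sub_mod M {\<zero>\<^bsub>M\<^esub>}) B"
  interpret A: right_module R A by fact
  have "f \<zero>\<^bsub>M\<^esub> = \<zero>\<^bsub>B\<^esub>"
    using right_hom_zero[OF right_module_sub_mod[OF right_module_axioms submodule_zero] B f] by simp
  moreover have "(\<lambda>_. \<zero>\<^bsub>A\<^esub>) \<in> right_hom R (sub_mod M {\<zero>\<^bsub>M\<^esub>}) A"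
    by (auto simp: right_hom_def hom_def)
  ultimately show "\<exists>h\<in>right_hom R (sub_mod M {\<zero>\<^bsub>M\<^esub>}) A. \<forall>x\<in>carrier (sub_mod M {\<zero>\<^bsub>M\<^esub>}). g (h x) = f x"
    using right_hom_zero[OF A B g] by (intro bexI) auto
qed

lemma direct_sum_unique:
  assumes P: "submodule P R M" and Q: "submodule Q R M" and PQ: "P \<inter> Q = {\<zero>\<^bsub>M\<^esub>}"
    and in_PQ: "p \<in> P" "p' \<in> P" "q \<in> Q" "q' \<in> Q" and eq: "p \<oplus>\<^bsub>M\<^esub> q = p' \<oplus>\<^bsub>M\<^esub> q'"
  shows "p = p' \<and> q = q'"
proof -
  have M: "p \<in> carrier M" "p' \<in> carrier M" "q \<in> carrier M" "q' \<in> carrier M"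
    using in_PQ submoduleD(1)[OF P] submoduleD(1)[OF Q] by auto
  have "q \<oplus>\<^bsub>M\<^esub> \<ominus>\<^bsub>M\<^esub> q' = (\<ominus>\<^bsub>M\<^esub> p \<oplus>\<^bsub>M\<^esub> (p \<oplus>\<^bsub>M\<^esub> q)) \<oplus>\<^bsub>M\<^esub> \<ominus>\<^bsub>M\<^esub> q'"
    using M by (simp add: M.r_neg1)
  also have "\<dots> = \<ominus>\<^bsub>M\<^esub> p \<oplus>\<^bsub>M\<^esub> p'"
    unfolding eq using M by (simp add: M.a_assoc M.r_neg)
  finally have d: "q \<oplus>\<^bsub>M\<^esub> \<ominus>\<^bsub>M\<^esub> q' = \<ominus>\<^bsub>M\<^esub> p \<oplus>\<^bsub>M\<^esub> p'" .
  have "q \<oplus>\<^bsub>M\<^esub> \<ominus>\<^bsub>M\<^esub> q' \<in> Q" using in_PQ submoduleD(3,5)[OF Q] by blast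
  moreover have "q \<oplus>\<^bsub>M\<^esub> \<ominus>\<^bsub>M\<^esub> q' \<in> P" unfolding d using in_PQ submoduleD(3,5)[OF P] by blast
  ultimately have "q \<oplus>\<^bsub>M\<^esub> \<ominus>\<^bsub>M\<^esub> q' = \<zero>\<^bsub>M\<^esub>" using PQ by blast
  then have "q = q'" using M M.minus_equality[of q "\<ominus>\<^bsub>M\<^esub> q'"] by simp
  then show ?thesis using eq M by simp
qed

text \<open>Lift on each summand and add the two lifts; uniqueness of the components makes the sum
  well defined.\<close>

lemma projective_direct_sum:
  assumes P: "submodule P R M" and Q: "submodule Q R M" and PQ: "P \<inter> Q = {\<zero>\<^bsub>M\<^esub>}"
    and projP: "projective_module R (sub_mod M P)" and projQ: "projective_module R (sub_mod M Q)"
  shows "projective_module R (sub_mod M (P <+>\<^bsub>M\<^esub> Q))"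
  unfolding projective_module_def
proof (intro allI impI, elim conjE)
  fix A :: "('r, 'm \<Rightarrow> 'r) module" and B :: "('r, 'm) module" and g f
  assume A: "right_module R A" and B: "right_module R B" and g: "g \<in> right_hom R A B"
    and surj: "g ` carrier A = carrier B" and f: "f \<in> right_hom R (sub_mod M (P <+>\<^bsub>M\<^esub> Q)) B"
  interpret A: right_module R A by fact
  note sub = subset_set_add[OF P Q]
  have restr: "f \<in> right_hom R (sub_mod M N) B" if "N \<subseteq> P <+>\<^bsub>M\<^esub> Q" for N
    using f that by (auto simp: right_hom_def hom_def subset_iff)
  have "\<exists>h\<in>right_hom R (sub_mod M P) A. \<forall>x\<in>carrier (sub_mod M P). g (h x) = f x"
    using projP[unfolded projective_module_def, rule_format, of A B g f]
      A B g surj restr[OF sub(1)] by blast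
  then obtain hP where hP: "hP \<in> right_hom R (sub_mod M P) A" "\<And>x. x \<in> P \<Longrightarrow> g (hP x) = f x"
    by auto
  have "\<exists>h\<in>right_hom R (sub_mod M Q) A. \<forall>x\<in>carrier (sub_mod M Q). g (h x) = f x"
    using projQ[unfolded projective_module_def, rule_format, of A B g f]
      A B g surj restr[OF sub(2)] by blast
  then obtain hQ where hQ: "hQ \<in> right_hom R (sub_mod M Q) A" "\<And>x. x \<in> Q \<Longrightarrow> g (hQ x) = f x"
    by auto
  note HP = right_homD[OF hP(1), simplified] and HQ = right_homD[OF hQ(1), simplified]
  note F = right_homD[OF f, simplified] and G = right_homD[OF g]
  note PM = submoduleD(1)[OF P] and QM = submoduleD(1)[OF Q]
  define h where "h x = (THE y. \<exists>p\<in>P. \<exists>q\<in>Q. x = p \<oplus>\<^bsub>M\<^esub> q \<and> y = hP p \<oplus>\<^bsub>A\<^esub> hQ q)" for x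
  have h: "h (p \<oplus>\<^bsub>M\<^esub> q) = hP p \<oplus>\<^bsub>A\<^esub> hQ q" if "p \<in> P" "q \<in> Q" for p q
    unfolding h_def
  proof (rule the_equality)
    show "\<exists>p'\<in>P. \<exists>q'\<in>Q. p \<oplus>\<^bsub>M\<^esub> q = p' \<oplus>\<^bsub>M\<^esub> q' \<and> hP p \<oplus>\<^bsub>A\<^esub> hQ q = hP p' \<oplus>\<^bsub>A\<^esub> hQ q'"
      by (rule bexI[of _ p], rule bexI[of _ q]) (use that in simp_all)
    fix y assume "\<exists>p'\<in>P. \<exists>q'\<in>Q. p \<oplus>\<^bsub>M\<^esub> q = p' \<oplus>\<^bsub>M\<^esub> q' \<and> y = hP p' \<oplus>\<^bsub>A\<^esub> hQ q'"
    then obtain p' q' where *: "p' \<in> P" "q' \<in> Q" "p \<oplus>\<^bsub>M\<^esub> q = p' \<oplus>\<^bsub>M\<^esub> q'" "y = hP p' \<oplus>\<^bsub>A\<^esub> hQ q'"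
      by (elim bexE conjE)
    then show "y = hP p \<oplus>\<^bsub>A\<^esub> hQ q"
      using direct_sum_unique[OF P Q PQ that(1) *(1) that(2) *(2,3)] by simp
  qed
  have "h \<in> right_hom R (sub_mod M (P <+>\<^bsub>M\<^esub> Q)) A"
    unfolding right_hom_def
  proof (intro CollectI conjI homI ballI)
    fix x assume "x \<in> carrier (add_monoid (sub_mod M (P <+>\<^bsub>M\<^esub> Q)))"
    then obtain p q where "p \<in> P" "q \<in> Q" "x = p \<oplus>\<^bsub>M\<^esub> q" by (auto simp: set_add_def')
    then show "h x \<in> carrier (add_monoid A)" using h HP(1) HQ(1) by simp
  next
    fix x y assume "x \<in> carrier (add_monoid (sub_mod M (P <+>\<^bsub>M\<^esub> Q)))"
      "y \<in> carrier (add_monoid (sub_mod M (P <+>\<^bsub>M\<^esub> Q)))"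
    then obtain p q p' q' where *: "p \<in> P" "q \<in> Q" "x = p \<oplus>\<^bsub>M\<^esub> q" "p' \<in> P" "q' \<in> Q" "y = p' \<oplus>\<^bsub>M\<^esub> q'"
      by (auto simp: set_add_def')
    have eq: "x \<oplus>\<^bsub>M\<^esub> y = (p \<oplus>\<^bsub>M\<^esub> p') \<oplus>\<^bsub>M\<^esub> (q \<oplus>\<^bsub>M\<^esub> q')"
      using * PM QM by (simp add: M.a_ac)
    have "h (x \<oplus>\<^bsub>M\<^esub> y) = hP (p \<oplus>\<^bsub>M\<^esub> p') \<oplus>\<^bsub>A\<^esub> hQ (q \<oplus>\<^bsub>M\<^esub> q')"
      unfolding eq using * submoduleD(3)[OF P] submoduleD(3)[OF Q] by (intro h) auto
    also have "\<dots> = h x \<oplus>\<^bsub>A\<^esub> h y"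
      using * h HP HQ by (simp add: A.a_ac)
    finally show "h (x \<otimes>\<^bsub>add_monoid (sub_mod M (P <+>\<^bsub>M\<^esub> Q))\<^esub> y) = h x \<otimes>\<^bsub>add_monoid A\<^esub> h y"
      by simp
  next
    fix x a assume "x \<in> carrier (sub_mod M (P <+>\<^bsub>M\<^esub> Q))" and a: "a \<in> carrier R"
    then obtain p q where *: "p \<in> P" "q \<in> Q" "x = p \<oplus>\<^bsub>M\<^esub> q" by (auto simp: set_add_def')
    have "h (x \<cdot>\<^bsub>M\<^esub> a) = hP (p \<cdot>\<^bsub>M\<^esub> a) \<oplus>\<^bsub>A\<^esub> hQ (q \<cdot>\<^bsub>M\<^esub> a)"
      using * a h submoduleD(4)[OF P] submoduleD(4)[OF Q] PM QM by (simp add: smult_add_vector)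
    also have "\<dots> = h x \<cdot>\<^bsub>A\<^esub> a"
      using * a h HP HQ by (simp add: A.smult_add_vector)
    finally show "h (x \<cdot>\<^bsub>sub_mod M (P <+>\<^bsub>M\<^esub> Q)\<^esub> a) = h x \<cdot>\<^bsub>A\<^esub> a" by simp
  qed
  moreover have "g (h x) = f x" if x: "x \<in> P <+>\<^bsub>M\<^esub> Q" for x
  proof -
    obtain p q where *: "p \<in> P" "q \<in> Q" "x = p \<oplus>\<^bsub>M\<^esub> q" using x by (auto simp: set_add_def')
    then have "g (h x) = f p \<oplus>\<^bsub>B\<^esub> f q" using h HP(1) HQ(1) G(2) hP(2) hQ(2) by simp
    also have "\<dots> = f x" using * F(2)[of p q] subsetD[OF sub(1)] subsetD[OF sub(2)] by simp
    finally show ?thesis .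
  qed
  ultimately show "\<exists>h\<in>right_hom R (sub_mod M (P <+>\<^bsub>M\<^esub> Q)) A.
      \<forall>x\<in>carrier (sub_mod M (P <+>\<^bsub>M\<^esub> Q)). g (h x) = f x"
    by (intro bexI) auto
qed

end

section \<open>Splitting off projective summands\<close>

text \<open>A nonzero projective summand \<open>p\<close> of \<open>N\<close> can be moved to the other side, since \<open>P\<close>, \<open>p\<close> and the
  complement \<open>N'\<close> of \<open>p\<close> in \<open>N\<close> are independent with sum \<open>M\<close>.\<close>

lemma (in right_module) split_projective_summand:
  assumes dec: "is_direct_sum R M P N" and proj: "projective_module R (sub_mod M P)"
    and unstable: "\<not> stable_module R (sub_mod M N)"
  shows "\<exists>p N'. is_direct_sum R M (P <+>\<^bsub>M\<^esub> p) N' \<and> projective_module R (sub_mod M (P <+>\<^bsub>M\<^esub> p)) \<and>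
    submodule p R M \<and> p \<noteq> {\<zero>\<^bsub>M\<^esub>} \<and> N = p <+>\<^bsub>M\<^esub> N' \<and> p \<inter> N' = {\<zero>\<^bsub>M\<^esub>}"
proof -
  interpret S: bounded_modular_lattice
    "{N. submodule N R M}" "(\<subseteq>)" "set_add M" "(\<inter>)" "{\<zero>\<^bsub>M\<^esub>}" "carrier M"
    by (rule submodule_lattice)
  have PN: "submodule P R M" "submodule N R M" "P <+>\<^bsub>M\<^esub> N = carrier M" "P \<inter> N = {\<zero>\<^bsub>M\<^esub>}"
    using dec by (auto simp: is_direct_sum_def)
  obtain p N' where p: "is_direct_sum R (sub_mod M N) p N'"
      "projective_module R (sub_mod (sub_mod M N) p)" "p \<noteq> {\<zero>\<^bsub>M\<^esub>}"
    using unstable by (auto simp: stable_module_def)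
  then have sub: "submodule p R M" "submodule N' R M" and eq: "p <+>\<^bsub>M\<^esub> N' = N" "p \<inter> N' = {\<zero>\<^bsub>M\<^esub>}"
    using submodule_sub_mod_iff[OF PN(2)] by (auto simp: is_direct_sum_def set_add_def')
  have projp: "projective_module R (sub_mod M p)" using p(2) by simp
  have "P \<inter> p \<subseteq> P \<inter> N" using eq(1) subset_set_add[OF sub] by auto
  then have Pp: "P \<inter> p = {\<zero>\<^bsub>M\<^esub>}" using PN(4) submoduleD(2)[OF PN(1)] submoduleD(2)[OF sub(1)] by auto
  have "N' \<inter> (P <+>\<^bsub>M\<^esub> p) = {\<zero>\<^bsub>M\<^esub>}"
    using S.disjoint_rotate[of N' p P] PN sub eq S.join_commute[of N' p] by (simp add: Int_commute)
  moreover have "(P <+>\<^bsub>M\<^esub> p) <+>\<^bsub>M\<^esub> N' = carrier M"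
    using S.join_assoc[of P p N'] PN sub eq by simp
  ultimately have "is_direct_sum R M (P <+>\<^bsub>M\<^esub> p) N'"
    using PN sub submodule_set_add by (simp add: is_direct_sum_def Int_commute)
  then show ?thesis
    using projective_direct_sum[OF PN(1) sub(1) Pp proj projp] sub eq p(3) by blast
qed

theorem theorem2p2:
  fixes R :: "('r, 'x) ring_scheme" and M :: "('r, 'm, 'y) module_scheme"
  assumes "ring R" and "right_module R M"
    and "udim R M < \<infinity> \<or> hdim R M < \<infinity>"
  shows "\<exists>P N. is_direct_sum R M P N \<and> projective_module R (sub_mod M P) \<and> stable_module R (sub_mod M N)"
proof (rule ccontr)
  assume contra: "\<not> ?thesis"
  interpret right_module R M by fact
  interpret S: bounded_modular_lattice
    "{N. submodule N R M}" "(\<subseteq>)" "set_add M" "(\<inter>)" "{\<zero>\<^bsub>M\<^esub>}" "carrier M"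
    by (rule submodule_lattice)
  define dec where "dec s \<longleftrightarrow> is_direct_sum R M (fst s) (snd s) \<and>
    projective_module R (sub_mod M (fst s))" for s
  define next_dec where "next_dec s t \<longleftrightarrow> (\<exists>p\<in>{N. submodule N R M}. p \<noteq> {\<zero>\<^bsub>M\<^esub>} \<and>
    fst t = fst s <+>\<^bsub>M\<^esub> p \<and> snd s = p <+>\<^bsub>M\<^esub> snd t \<and> p \<inter> snd t = {\<zero>\<^bsub>M\<^esub>})" for s t
  have "\<exists>s. \<forall>j::nat. dec (s j) \<and> next_dec (s j) (s (Suc j))"
  proof (rule dependent_nat_choice)
    have "{\<zero>\<^bsub>M\<^esub>} <+>\<^bsub>M\<^esub> carrier M = carrier M"
      using S.join_commute[of "{\<zero>\<^bsub>M\<^esub>}" "carrier M"] S.join_bot[of "carrier M"]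
        submodule_zero submodule_carrier by simp
    then show "\<exists>s. dec s"
      using submodule_zero submodule_carrier projective_zero
      by (intro exI[of _ "({\<zero>\<^bsub>M\<^esub>}, carrier M)"]) (auto simp: dec_def is_direct_sum_def)
  next
    fix s and j :: nat
    assume s: "dec s"
    then have "\<not> stable_module R (sub_mod M (snd s))" using contra by (auto simp: dec_def)
    then obtain p N' where "dec (fst s <+>\<^bsub>M\<^esub> p, N')" "submodule p R M" "p \<noteq> {\<zero>\<^bsub>M\<^esub>}"
        "snd s = p <+>\<^bsub>M\<^esub> N'" "p \<inter> N' = {\<zero>\<^bsub>M\<^esub>}"
      using split_projective_summand[of "fst s" "snd s"] s by (auto simp: dec_def)
    then show "\<exists>t. dec t \<and> next_dec s t"
      by (intro exI[of _ "(fst s <+>\<^bsub>M\<^esub> p, N')"]) (auto simp: next_dec_def)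
  qed
  then obtain s where s: "\<And>j::nat. dec (s j)" "\<And>j. next_dec (s j) (s (Suc j))" by blast
  have "(\<exists>n. has_udim R M n) \<or> (\<exists>n. has_hdim R M n)"
    using assms(3) by (auto simp: udim_def hdim_def split: if_splits)
  then have "S.finite_dim \<or> bounded_modular_lattice.finite_dim {N. submodule N R M}
      (\<lambda>A B. B \<subseteq> A) (\<inter>) (set_add M) (carrier M) {\<zero>\<^bsub>M\<^esub>}"
    using finite_dim_of_has_udim dual_finite_dim_of_has_hdim by blast
  then show False
    by (rule S.no_infinite_complement_sequence[of "\<lambda>j. fst (s j)" "\<lambda>j. snd (s j)"])
      (use s in \<open>auto simp: dec_def is_direct_sum_def next_dec_def\<close>)
qed

end
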